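(* Let $\gamma\in(0,2)$. A $\mathrm{GTGS}_\gamma(\alpha,\lambda,\theta,\delta;\mu)$ law on $\mathbb R$ with $\alpha_+,\alpha_-\in(0,1)$ admits both a spectral density $s$ and a Rosi\'nski density $r_\gamma$ (densities with respect to Lebesgue measure of its spectral measure $Q$ and of its Rosi\'nski measure $R$), given respectively by $$\begin{aligned}s(x)=\;&\delta_+\frac{(x-\theta_+)^{\alpha_+-1}}{\pi}\,\frac{\sin(\alpha_+\pi)}{\lambda_+^{-1}(x-\theta_+)^{2\alpha_+}+2(x-\theta_+)^{\alpha_+}\cos(\alpha_+\pi)+\lambda_+}\mathbf 1_{\{x>\theta_+\}}\\&+\delta_-\frac{(|x|-\theta_-)^{\alpha_--1}}{\pi}\,\frac{\sin(\alpha_-\pi)}{\lambda_-^{-1}(|x|-\theta_-)^{2\alpha_-}+2(|x|-\theta_-)^{\alpha_-}\cos(\alpha_-\pi)+\lambda_-}\mathbf 1_{\{x<-\theta_-\}}\end{aligned}$$ and, with the convention $1/0:=\infty$, $$\begin{aligned}r_\gamma(x)=\;&\delta_+\frac{x^{-\gamma+\alpha_+-1}}{\pi}\,\frac{(1-\theta_+x)^{\alpha_+-1}\sin(\alpha_+\pi)}{\lambda_+^{-1}(1-\theta_+x)^{2\alpha_+}+2(x(1-\theta_+x))^{\alpha_+}\cos(\alpha_+\pi)+\lambda_+x^{2\alpha_+}}\mathbf 1_{\{0<x<\theta_+^{-1}\}}\\&+\delta_-\frac{|x|^{-\gamma+\alpha_--1}}{\pi}\,\frac{(1-\theta_-|x|)^{\alpha_--1}\sin(\alpha_-\pi)}{\lambda_-^{-1}(1-\theta_-|x|)^{2\alpha_-}+2(|x|(1-\theta_-|x|))^{\alpha_-}\cos(\alpha_-\pi)+\lambda_-|x|^{2\alpha_-}}\mathbf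 1_{\{-\theta_-^{-1}<x<0\}}.\end{aligned}$$
   Context: For $a\in(0,1]$, $E_a(z)=\sum_{k\ge0}z^k/\Gamma(ak+1)$. Let $\alpha=(\alpha_+,\alpha_-)\in(0,1]^2$, $\lambda=(\lambda_+,\lambda_-)\in(0,\infty)^2$, $\theta=(\theta_+,\theta_-)\in[0,\infty)^2$, $\delta=(\delta_+,\delta_-)\in[0,\infty)^2\setminus\{(0,0)\}$, $\mu\in\mathbb R$. Here $\gamma_+=\gamma_-=\gamma$, and $\mathrm{GTGS}_\gamma(\alpha,\lambda,\theta,\delta;\mu)$ is the infinitely divisible law on $\mathbb R$ with L\'evy triplet $(\mu,0,m(x)dx)$, with respect to the truncation function $x\mathbf 1_{\{|x|<1\}}$, where $$m(x)=\delta_+\frac{e^{-\theta_+x}}{x^{1+\gamma}}E_{\alpha_+}(-\lambda_+x^{\alpha_+})\mathbf 1_{\{x>0\}}+\delta_-\frac{e^{-\theta_-|x|}}{|x|^{1+\gamma}}E_{\alpha_-}(-\lambda_-|x|^{\alpha_-})\mathbf 1_{\{x<0\}}.$$ In polar form, with $S^0=\{1,-1\}$, its L\'evy measure is $q(r,u)r^{-1-\gamma}dr\,\sigma(du)$ with $q(r,\pm1)=e^{-\theta_\pm r}E_{\alpha_\pm}(-\lambda_\pm r^{\alpha_\pm})$, $r>0$, and $\sigma(\{\pm1\})=\delta_\pm$. Spectral and Rosi\'nski measures: for each $u$, $q(\cdot,u)$ is completely monotone, and $Q_u$ is the probability measure on $\mathbb R_+$ with $q(r,u)=\int_0^\infty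 e^{-rs}Q_u(ds)$. For Borel $B\subseteq\mathbb R\setminus\{0\}$, the spectral measure is $Q(B)=\int_{S^0}\sigma(du)\int_{\mathbb R_+}\mathbf 1_B(ru)\,Q_u(dr)$, and the Rosi\'nski measure is $R(B)=\int_{\mathbb R}\mathbf 1_B(x/|x|^2)\,|x|^\gamma\,Q(dx)$. *)

theory Defs
  imports "HOL-Probability.Probability"
begin

definition mittag_leffler :: "real \<Rightarrow> real \<Rightarrow> real" where
  "mittag_leffler a z = (\<Sum>k. z ^ k / Gamma (a * real k + 1))"

(* M has the Levy-Khintchine representation with drift b, Gaussian variance a and Levy
   measure \<nu>, with respect to the truncation function x * 1_{|x| < 1}.
   In particular M is infinitely divisible. *)
definition has_levy_triplet :: "real measure \<Rightarrow> real \<Rightarrow> real \<Rightarrow> real measure \<Rightarrow> bool" where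
  "has_levy_triplet M b a \<nu> \<longleftrightarrow>
     real_distribution M \<and> 0 \<le> a \<and>
     sets \<nu> = sets borel \<and> emeasure \<nu> {0} = 0 \<and> (\<integral>\<^sup>+ x. ennreal (min 1 (x\<^sup>2)) \<partial>\<nu>) < \<infinity> \<and>
     (\<forall>t. char M t =
        exp (\<i> * of_real (b * t) - of_real (a * t\<^sup>2 / 2) +
             (CLINT x|\<nu>. iexp (t * x) - 1 - \<i> * of_real (t * x * indicator {-1<..<1} x))))"

(* Two-component parameters are pairs (plus component, minus component). *)

fun GTGS_levy_density ::
  "real \<Rightarrow> real \<times> real \<Rightarrow> real \<times> real \<Rightarrow> real \<times> real \<Rightarrow> real \<times> real \<Rightarrow> real \<Rightarrow> real" where
  "GTGS_levy_density \<gamma> (\<alpha>p, \<alpha>m) (lp, lm) (\<theta>p, \<theta>m) (\<delta>p, \<delta>m) x =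
     \<delta>p * (exp (- \<theta>p * x) / x powr (1 + \<gamma>)) *
       mittag_leffler \<alpha>p (- lp * x powr \<alpha>p) * indicator {0<..} x +
     \<delta>m * (exp (- \<theta>m * \<bar>x\<bar>) / \<bar>x\<bar> powr (1 + \<gamma>)) *
       mittag_leffler \<alpha>m (- lm * \<bar>x\<bar> powr \<alpha>m) * indicator {..<0} x"

definition GTGS_law ::
  "real \<Rightarrow> real \<times> real \<Rightarrow> real \<times> real \<Rightarrow> real \<times> real \<Rightarrow> real \<times> real \<Rightarrow> real \<Rightarrow> real measure \<Rightarrow> bool" where
  "GTGS_law \<gamma> \<alpha> l \<theta> \<delta> \<mu> M \<longleftrightarrow>
     has_levy_triplet M \<mu> 0 (density lborel (\<lambda>x. ennreal (GTGS_levy_density \<gamma> \<alpha> l \<theta> \<delta> x)))"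

(* q(r,u) and \<sigma> of the polar form; the unit sphere of the real line is {1, -1}. *)

fun GTGS_q :: "real \<times> real \<Rightarrow> real \<times> real \<Rightarrow> real \<times> real \<Rightarrow> real \<Rightarrow> real \<Rightarrow> real" where
  "GTGS_q (\<alpha>p, \<alpha>m) (lp, lm) (\<theta>p, \<theta>m) r u =
     (if u = 1 then exp (- \<theta>p * r) * mittag_leffler \<alpha>p (- lp * r powr \<alpha>p)
      else exp (- \<theta>m * r) * mittag_leffler \<alpha>m (- lm * r powr \<alpha>m))"

fun GTGS_sigma :: "real \<times> real \<Rightarrow> real measure" where
  "GTGS_sigma (\<delta>p, \<delta>m) = point_measure {1, -1} (\<lambda>u. ennreal (if u = 1 then \<delta>p else \<delta>m))"

(* q(r,u) r^(-1-\<gamma>) dr \<sigma>(du) *)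
definition polar_measure :: "real \<Rightarrow> real measure \<Rightarrow> (real \<Rightarrow> real \<Rightarrow> real) \<Rightarrow> real measure" where
  "polar_measure \<gamma> \<sigma> q = measure_of UNIV (sets borel)
     (\<lambda>B. \<integral>\<^sup>+ u. (\<integral>\<^sup>+ r. indicator B (r * u) * indicator {0<..} r *
                    ennreal (q r u * r powr (- 1 - \<gamma>)) \<partial>lborel) \<partial>\<sigma>)"

definition represents_laplace :: "real measure \<Rightarrow> (real \<Rightarrow> real) \<Rightarrow> bool" where
  "represents_laplace P f \<longleftrightarrow>
     real_distribution P \<and> (AE s in P. 0 \<le> s) \<and> (\<forall>r>0. f r = (\<integral>s. exp (- r * s) \<partial>P))"

(* Q_u, for f = q(., u) *)
definition laplace_measure :: "(real \<Rightarrow> real) \<Rightarrow> real measure" where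
  "laplace_measure f = (THE P. represents_laplace P f)"

(* The spectral and Rosinski measures live on the real line without the origin. *)

definition spectral_measure :: "real measure \<Rightarrow> (real \<Rightarrow> real \<Rightarrow> real) \<Rightarrow> real measure" where
  "spectral_measure \<sigma> q = measure_of (- {0}) (sets (restrict_space borel (- {0})))
     (\<lambda>B. \<integral>\<^sup>+ u. (\<integral>\<^sup>+ r. indicator B (r * u) \<partial>laplace_measure (\<lambda>r. q r u)) \<partial>\<sigma>)"

definition rosinski_measure :: "real \<Rightarrow> real measure \<Rightarrow> real measure" where
  "rosinski_measure \<gamma> Q = measure_of (- {0}) (sets (restrict_space borel (- {0})))
     (\<lambda>B. \<integral>\<^sup>+ x. indicator B (x / \<bar>x\<bar>\<^sup>2) * ennreal (\<bar>x\<bar> powr \<gamma>) \<partial>Q)"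

definition has_lebesgue_density :: "real measure \<Rightarrow> (real \<Rightarrow> real) \<Rightarrow> bool" where
  "has_lebesgue_density N f \<longleftrightarrow>
     f \<in> borel_measurable borel \<and> (\<forall>x. 0 \<le> f x) \<and>
     N = density (restrict_space lborel (space N)) (\<lambda>x. ennreal (f x))"

end

theory Submission
  imports Defs "HOL-Real_Asymp.Real_Asymp"
begin

text \<open>
  The whole statement rests on one identity: for \<open>0 < a < 1\<close>, \<open>l > 0\<close> and \<open>r > 0\<close>,
  \<open>E\<^sub>a(- l r\<^sup>a)\<close> is the Laplace transform at \<open>r\<close> of the probability density
  \<open>f(s) = s powr (a - 1) / \<pi> * sin (a\<pi>) / (s powr (2a) / l + 2 s powr a * cos (a\<pi>) + l)\<close>
  on the positive half-line.  Multiplication by \<open>exp (- \<theta> r)\<close> translates the density by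
  \<open>\<theta>\<close>, and a finite measure on the half-line is determined by its Laplace transform, so \<open>Q\<^sub>1\<close> and
  \<open>Q\<^sub>-\<^sub>1\<close> are the two translated densities.  The spectral measure glues them
  together on the two half-lines, and the Rosinski density follows by the substitution \<open>x \<mapsto> 1/x\<close>.

  The identity is a Hankel contour integral.  Classically one collapses a contour around the
  negative real axis, its branch cut, across which \<open>w powr (a - 1) / (w\<^sup>a + l)\<close> jumps by a
  multiple of \<open>f\<close>.  In the coordinate \<open>w = exp z\<close> the cut disappears: the
  slit plane becomes the strip \<open>\<bar>Im z\<bar> \<le> \<pi>\<close>, circles around the origin become vertical
  segments, and the integrand is holomorphic on a neighbourhood of the closed strip.  Let \<open>A(x)\<close> be
  its mean over the segment with real part \<open>x\<close>.  Differentiating under the integral sign and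
  integrating back in the vertical direction gives \<open>A'(x) = Im (G (x + i\<pi>)) / \<pi>\<close>
  (\<open>strip_mean_has_derivative\<close>), which is \<open>exp (- r s) f(s) s\<close> at \<open>s = exp x\<close>
  (\<open>Im_ml_kernel_pi\<close>).  Hence the Laplace transform of \<open>f\<close> is the total increment of
  \<open>A\<close>.  At \<open>-\<infinity>\<close> the mean vanishes.  At \<open>+\<infinity>\<close> one expands
  \<open>w\<^sup>a / (w\<^sup>a + l)\<close> in powers of \<open>l / w\<^sup>a\<close>; each term is a Hankel integral
  with limit \<open>1 / \<Gamma> (a n + 1)\<close>, after scaling to \<open>r = 1\<close>
  (\<open>hankel_mean_limit\<close>), and bounds that are geometric in \<open>n\<close>
  permit the limit to be taken term by term (\<open>ml_mean_at_top_unit\<close>).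
  The Hankel integrals are treated by the same differentiation formula: for exponents in
  \<open>(-1, 0)\<close> it reduces them to the Gamma integral and the reflection formula, and a recursion in
  the exponent, matching \<open>\<Gamma> (z + 1) = z \<Gamma> z\<close>, does the rest.

  Uniqueness of the representing measure (\<open>represents_laplace_unique\<close>) uses that
  \<open>exp (- s)\<close> takes values in \<open>[0, 1]\<close> and has the values of the Laplace transform at the
  integers as its moments, so its characteristic function is determined.
\<close>

section \<open>Means over the vertical segments of a strip\<close>

text \<open>
  The real part loses nothing: every function to which this is applied satisfies
  \<open>G (cnj z) = cnj (G z)\<close>, so its integral over a segment symmetric about the real axis is real.
\<close>

definition strip_mean :: "(complex \<Rightarrow> complex) \<Rightarrow> real \<Rightarrow> real" where
  "strip_mean G x = Re (integral {-pi..pi} (\<lambda>y. G (Complex x y))) / (2 * pi)"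

lemma continuous_on_vertical:
  assumes "continuous_on {z. \<bar>Im z\<bar> \<le> pi} G"
  shows "continuous_on {-pi..pi} (\<lambda>y. G (Complex x y))"
  by (rule continuous_on_compose2[OF assms]) (auto intro!: continuous_intros simp: Complex_eq)

lemma integral_vertical_derivative:
  assumes G: "\<And>z. \<bar>Im z\<bar> \<le> pi \<Longrightarrow> (G has_field_derivative G' z) (at z)"
  shows "((\<lambda>y. G' (Complex x y)) has_integral
           (- \<i> * (G (Complex x pi) - G (Complex x (- pi))))) {-pi..pi}"
proof -
  have D: "((\<lambda>y. G (Complex x y)) has_vector_derivative \<i> * G' (Complex x y)) (at y within {-pi..pi})" if y: "y \<in> {-pi..pi}" for y
  proof -
    have 1: "((\<lambda>y. Complex x y) has_vector_derivative \<i>) (at y within {-pi..pi})"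
      by (simp add: has_vector_derivative_complex_iff)
    have 2: "(G has_field_derivative G' (Complex x y)) (at (Complex x y) within (\<lambda>y. Complex x y) ` {-pi..pi})"
      using y by (intro has_field_derivative_at_within[OF G]) auto
    from field_vector_diff_chain_within[OF 1 2] show ?thesis by (simp only: o_def)
  qed
  have "((\<lambda>y. \<i> * G' (Complex x y)) has_integral (G (Complex x pi) - G (Complex x (- pi)))) {-pi..pi}"
    by (rule fundamental_theorem_of_calculus[OF _ D]) auto
  from has_integral_mult_right[OF this, of "- \<i>"]
  show ?thesis by (simp add: mult.assoc[symmetric])
qed

lemma Re_vertical_increment:
  assumes "\<And>z. G (cnj z) = cnj (G z)"
  shows "Re (- \<i> * (G (Complex x pi) - G (Complex x (- pi)))) = 2 * Im (G (Complex x pi))"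
proof -
  have "Complex x (- pi) = cnj (Complex x pi)" by (simp add: complex_eq_iff)
  then show ?thesis using assms by simp
qed

text \<open>
  Along a vertical segment \<open>G'\<close> is, up to the factor \<open>\<i>\<close>, the derivative of \<open>G\<close>; the
  integral is therefore the difference of two conjugate end values.
\<close>

lemma strip_mean_of_derivative:
  assumes G: "\<And>z. \<bar>Im z\<bar> \<le> pi \<Longrightarrow> (G has_field_derivative G' z) (at z)"
    and sym: "\<And>z. G (cnj z) = cnj (G z)"
  shows "strip_mean G' x = Im (G (Complex x pi)) / pi"
proof -
  have "Re (integral {-pi..pi} (\<lambda>y. G' (Complex x y))) = 2 * Im (G (Complex x pi))"
    by (metis integral_unique integral_vertical_derivative[OF G] Re_vertical_increment[of G, OF sym])
  then show ?thesis by (simp add: strip_mean_def)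
qed

text \<open>
  The only contour-shifting tool needed here.  The horizontal derivative of the mean is the mean of the
  complex derivative, which by the previous argument sees only the end points of the segment, that is,
  the two sides of the branch cut in the coordinate \<open>exp z\<close>.
\<close>

lemma strip_mean_has_derivative:
  assumes G: "\<And>z. \<bar>Im z\<bar> \<le> pi \<Longrightarrow> (G has_field_derivative G' z) (at z)"
    and G': "continuous_on {z. \<bar>Im z\<bar> \<le> pi} G'"
    and sym: "\<And>z. G (cnj z) = cnj (G z)"
  shows "(strip_mean G has_real_derivative Im (G (Complex x pi)) / pi) (at x)"
proof -
  have contG: "continuous_on {z. \<bar>Im z\<bar> \<le> pi} G"
    by (rule DERIV_continuous_on[of _ _ G']) (rule has_field_derivative_at_within, rule G, simp)
  have D: "((\<lambda>x. G (Complex x t)) has_vector_derivative G' (Complex x t)) (at x within UNIV)"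
    if t: "t \<in> cbox (-pi) pi" for x t
  proof -
    have 1: "((\<lambda>x. Complex x t) has_vector_derivative 1) (at x within UNIV)"
      by (simp add: has_vector_derivative_complex_iff)
    have 2: "(G has_field_derivative G' (Complex x t)) (at (Complex x t) within (\<lambda>x. Complex x t) ` UNIV)"
      using t by (intro has_field_derivative_at_within[OF G]) auto
    from field_vector_diff_chain_within[OF 1 2] show ?thesis by (simp only: o_def mult_1)
  qed
  have "((\<lambda>x. integral (cbox (-pi) pi) (\<lambda>y. G (Complex x y))) has_vector_derivative
          integral (cbox (-pi) pi) (\<lambda>y. G' (Complex x y))) (at x within UNIV)"
  proof (rule leibniz_rule_vector_derivative[OF D])
    fix x :: real
    show "(\<lambda>y. G (Complex x y)) integrable_on cbox (-pi) pi"
      using continuous_on_vertical[OF contG] by (intro integrable_continuous) simp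
  next
    show "continuous_on (UNIV \<times> cbox (-pi) pi) (\<lambda>(x, t). G' (Complex x t))"
      unfolding case_prod_unfold
      by (rule continuous_on_compose2[OF G']) (auto intro!: continuous_intros simp: Complex_eq)
  qed auto
  then have "((\<lambda>x. integral {-pi..pi} (\<lambda>y. G (Complex x y))) has_vector_derivative
          (- \<i> * (G (Complex x pi) - G (Complex x (- pi))))) (at x)"
    using integral_unique[OF integral_vertical_derivative[OF G, of x]] by simp
  from bounded_linear.has_vector_derivative[OF bounded_linear_Re this]
  have "((\<lambda>x. Re (integral {-pi..pi} (\<lambda>y. G (Complex x y)))) has_real_derivative
          2 * Im (G (Complex x pi))) (at x)"
    unfolding Re_vertical_increment[of G x, OF sym] has_real_derivative_iff_has_vector_derivative .
  from DERIV_cdivide[OF this, of "2 * pi"] show ?thesis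
    unfolding strip_mean_def[abs_def] by simp
qed

lemma strip_mean_bound:
  assumes "continuous_on {z. \<bar>Im z\<bar> \<le> pi} G"
    and "\<And>y. \<bar>y\<bar> \<le> pi \<Longrightarrow> norm (G (Complex x y)) \<le> C"
  shows "\<bar>strip_mean G x\<bar> \<le> C"
proof -
  have "norm (integral {-pi..pi} (\<lambda>y. G (Complex x y))) \<le> C * (pi - (-pi))"
    by (rule integral_bound) (use assms continuous_on_vertical in auto)
  then have "\<bar>Re (integral {-pi..pi} (\<lambda>y. G (Complex x y)))\<bar> \<le> C * (2 * pi)"
    using abs_Re_le_cmod order_trans by fastforce
  then show ?thesis unfolding strip_mean_def by (simp add: divide_simps)
qed

lemma strip_mean_diff:
  assumes "continuous_on {z. \<bar>Im z\<bar> \<le> pi} G" "continuous_on {z. \<bar>Im z\<bar> \<le> pi} H"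
  shows "strip_mean (\<lambda>z. G z - of_real c * H z) x = strip_mean G x - c * strip_mean H x"
proof -
  have "(\<lambda>y. G (Complex x y)) integrable_on {-pi..pi}"
    and "(\<lambda>y. of_real c * H (Complex x y)) integrable_on {-pi..pi}"
    by (intro integrable_continuous_real continuous_on_vertical continuous_on_mult_left assms)+
  then show ?thesis
    by (simp add: strip_mean_def integral_diff diff_divide_distrib)
qed

lemma strip_mean_diff_sum:
  assumes G: "continuous_on {z. \<bar>Im z\<bar> \<le> pi} G" and H: "\<And>n. continuous_on {z. \<bar>Im z\<bar> \<le> pi} (H n)"
  shows "strip_mean (\<lambda>z. G z - (\<Sum>n<N. of_real (c n) * H n z)) x
    = strip_mean G x - (\<Sum>n<(N::nat). c n * strip_mean (H n) x)"
proof (induction N)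
  case (Suc N)
  have "continuous_on {z. \<bar>Im z\<bar> \<le> pi} (\<lambda>z. G z - (\<Sum>n<N. of_real (c n) * H n z))"
    by (intro continuous_intros G H)
  from strip_mean_diff[OF this H, of "c N" N x] show ?case
    using Suc.IH by (simp add: diff_diff_eq)
qed simp

lemma strip_mean_tendsto:
  assumes cont: "continuous_on {z. \<bar>Im z\<bar> \<le> pi} G"
    and lim: "\<And>e. 0 < e \<Longrightarrow> \<forall>\<^sub>F x in F. \<forall>y. \<bar>y\<bar> \<le> pi \<longrightarrow> norm (G (Complex x y) - of_real c) \<le> e"
  shows "(strip_mean G \<longlongrightarrow> c) F"
proof -
  have eq: "strip_mean (\<lambda>z. G z - of_real c) x = strip_mean G x - c" for x
  proof -
    have "(\<lambda>y. G (Complex x y)) integrable_on {-pi..pi}"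
      by (intro integrable_continuous_real continuous_on_vertical cont)
    then show ?thesis
      by (simp add: strip_mean_def integral_diff[OF _ integrable_const_ivl] diff_divide_distrib)
  qed
  have cont': "continuous_on {z. \<bar>Im z\<bar> \<le> pi} (\<lambda>z. G z - of_real c)"
    by (intro continuous_intros cont)
  show ?thesis
  proof (rule tendstoI)
    fix e :: real assume e: "0 < e"
    from lim[OF half_gt_zero[OF e]]
    show "\<forall>\<^sub>F x in F. dist (strip_mean G x) c < e"
    proof (rule eventually_mono)
      fix x assume "\<forall>y. \<bar>y\<bar> \<le> pi \<longrightarrow> norm (G (Complex x y) - of_real c) \<le> e / 2"
      then have "\<bar>strip_mean (\<lambda>z. G z - of_real c) x\<bar> \<le> e / 2"
        by (intro strip_mean_bound[OF cont']) auto
      with e show "dist (strip_mean G x) c < e" by (simp add: dist_real_def eq)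
    qed
  qed
qed

section \<open>Hankel's formula for the reciprocal Gamma function\<close>

text \<open>
  Hankel's formula is \<open>1 / \<Gamma> (\<nu> + 1) = 1 / (2\<pi>\<i>) * \<integral> exp w * w powr (- \<nu>) * dw / w\<close>;
  this is its integrand in the coordinate \<open>w = exp z\<close>, in which \<open>dw / w = dz\<close>.
\<close>

definition hankel_kernel :: "real \<Rightarrow> complex \<Rightarrow> complex" where
  "hankel_kernel \<nu> z = exp (exp z - of_real \<nu> * z)"

lemma hankel_kernel_deriv:
  "(hankel_kernel \<nu> has_field_derivative hankel_kernel (\<nu> - 1) z - of_real \<nu> * hankel_kernel \<nu> z) (at z)"
proof -
  have "exp (exp z - of_real (\<nu> - 1) * z) = exp (exp z - of_real \<nu> * z) * exp z"
    by (simp add: exp_add[symmetric] algebra_simps)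
  moreover have "((\<lambda>z. exp (exp z - of_real \<nu> * z)) has_field_derivative
      exp (exp z - of_real \<nu> * z) * (exp z - of_real \<nu>)) (at z)"
    by (auto intro!: derivative_eq_intros)
  ultimately show ?thesis
    unfolding hankel_kernel_def[abs_def] by (simp add: algebra_simps)
qed

lemma continuous_on_hankel_kernel [continuous_intros]: "continuous_on S (hankel_kernel \<nu>)"
  unfolding hankel_kernel_def by (intro continuous_intros)

lemma hankel_kernel_cnj: "hankel_kernel \<nu> (cnj z) = cnj (hankel_kernel \<nu> z)"
  by (simp add: hankel_kernel_def exp_cnj)

lemma norm_hankel_kernel_le: "norm (hankel_kernel \<nu> (Complex x y)) \<le> exp (exp x - \<nu> * x)"
  by (simp add: hankel_kernel_def Re_exp)

lemma Im_hankel_kernel_pi: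
  "Im (hankel_kernel \<nu> (Complex x pi)) = - exp (- exp x - \<nu> * x) * sin (\<nu> * pi)"
  by (simp add: hankel_kernel_def Im_exp Re_exp)

lemma hankel_mean_deriv:
  "(strip_mean (hankel_kernel \<nu>) has_real_derivative
     - (sin (\<nu> * pi) / pi) * exp (- exp x - \<nu> * x)) (at x)"
  using strip_mean_has_derivative[of "hankel_kernel \<nu>", OF hankel_kernel_deriv _ hankel_kernel_cnj, of x]
  unfolding Im_hankel_kernel_pi by (simp add: continuous_intros mult.commute)

text \<open>
  Integration by parts on the segment: the derivative of the kernel is a combination of the kernels
  with exponents \<open>\<nu> - 1\<close> and \<open>\<nu>\<close>, and its mean is a boundary term that vanishes as
  \<open>x \<rightarrow> \<infinity>\<close>.
\<close>

lemma hankel_mean_recursion: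
  "strip_mean (hankel_kernel (\<nu> - 1)) x - \<nu> * strip_mean (hankel_kernel \<nu>) x
     = - (sin (\<nu> * pi) / pi) * exp (- exp x - \<nu> * x)"
proof -
  have "strip_mean (\<lambda>z. hankel_kernel (\<nu> - 1) z - of_real \<nu> * hankel_kernel \<nu> z) x
     = - (sin (\<nu> * pi) / pi) * exp (- exp x - \<nu> * x)"
    by (subst strip_mean_of_derivative[OF hankel_kernel_deriv hankel_kernel_cnj])
       (simp add: Im_hankel_kernel_pi)
  then show ?thesis
    by (simp add: strip_mean_diff continuous_on_hankel_kernel)
qed

lemma hankel_mean_at_bot:
  assumes "\<nu> < 0"
  shows "(strip_mean (hankel_kernel \<nu>) \<longlongrightarrow> 0) at_bot"
proof (rule Lim_null_comparison)
  show "\<forall>\<^sub>F x in at_bot. norm (strip_mean (hankel_kernel \<nu>) x) \<le> exp (exp x - \<nu> * x)"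
    by (intro always_eventually allI)
       (simp add: strip_mean_bound continuous_intros norm_hankel_kernel_le)
  show "((\<lambda>x. exp (exp x - \<nu> * x)) \<longlongrightarrow> 0) at_bot"
    using assms by real_asymp
qed

lemma exp_neg_exp_lim: "((\<lambda>x::real. exp (- exp x - \<nu> * x)) \<longlongrightarrow> 0) at_top"
  by real_asymp

text \<open>
  The boundary values at \<open>\<plusminus> \<i>\<pi>\<close> are real for \<open>\<nu> = 0\<close>, so the mean is constant; far to
  the left the integrand \<open>exp (exp z)\<close> is uniformly close to 1.
\<close>

lemma hankel_mean_0: "strip_mean (hankel_kernel 0) x = 1"
proof -
  have lim: "(strip_mean (hankel_kernel 0) \<longlongrightarrow> 1) at_bot"
  proof (rule strip_mean_tendsto)
    fix e :: real assume e: "0 < e"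
    have "(exp \<longlongrightarrow> exp (0::complex)) (at 0)" by (rule tendsto_exp) (rule tendsto_ident_at)
    from tendstoD[OF this e] have "\<exists>d>0. \<forall>w::complex. w \<noteq> 0 \<and> norm w < d \<longrightarrow> norm (exp w - 1) < e"
      by (simp add: eventually_at dist_norm)
    then obtain d where d: "d > 0" "\<And>w::complex. w \<noteq> 0 \<Longrightarrow> norm w < d \<Longrightarrow> norm (exp w - 1) < e"
      by blast
    have "\<forall>\<^sub>F x in at_bot. exp x < (d::real)"
      using order_tendstoD(2)[OF exp_at_bot d(1)] .
    then show "\<forall>\<^sub>F x in at_bot. \<forall>y. \<bar>y\<bar> \<le> pi \<longrightarrow> norm (hankel_kernel 0 (Complex x y) - of_real 1) \<le> e"
    proof (rule eventually_mono, intro allI impI)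
      fix x y :: real assume "exp x < d"
      then have "norm (exp (exp (Complex x y)) - 1) < e" by (intro d(2)) auto
      then show "norm (hankel_kernel 0 (Complex x y) - of_real 1) \<le> e"
        by (simp add: hankel_kernel_def)
    qed
  qed (rule continuous_on_hankel_kernel)
  have "strip_mean (hankel_kernel 0) t = strip_mean (hankel_kernel 0) x" for t
    by (rule DERIV_isconst_all) (use hankel_mean_deriv[of 0] in simp)
  then have "strip_mean (hankel_kernel 0) = (\<lambda>_. strip_mean (hankel_kernel 0) x)" by auto
  with lim have "((\<lambda>_. strip_mean (hankel_kernel 0) x) \<longlongrightarrow> 1) (at_bot :: real filter)" by simp
  from tendsto_unique[OF _ this tendsto_const] show ?thesis by simp
qed

lemma Gamma_reflection_neg_real:
  fixes \<nu> :: real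
  assumes "-1 < \<nu>" "\<nu> < 0"
  shows "- (sin (\<nu> * pi) / pi) * Gamma (- \<nu>) = rGamma (\<nu> + 1)"
proof -
  have "of_real (rGamma (\<nu> + 1) * rGamma (- \<nu>)) = (complex_of_real (sin (pi * (\<nu> + 1)) / pi))"
    using rGamma_reflection_complex[of "of_real (\<nu> + 1)"]
    by (simp add: rGamma_complex_of_real[symmetric] sin_of_real[symmetric])
  then have "rGamma (\<nu> + 1) * rGamma (- \<nu>) = sin (pi * (\<nu> + 1)) / pi"
    unfolding of_real_eq_iff .
  moreover have "sin (pi * (\<nu> + 1)) = - sin (\<nu> * pi)"
    by (simp add: distrib_left mult.commute)
  moreover have "rGamma (- \<nu>) * Gamma (- \<nu>) = 1"
    using Gamma_real_pos[of "- \<nu>"] assms by (simp add: rGamma_inverse_Gamma less_imp_neq[symmetric])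
  ultimately show ?thesis by (metis mult.assoc mult.right_neutral minus_divide_left)
qed

text \<open>
  For these exponents the mean starts from 0 at \<open>-\<infinity>\<close> and its derivative is integrable, so the
  limit is the integral of the derivative.  In the variable \<open>s = exp x\<close> the latter is
  \<open>- sin (\<nu>\<pi>) / \<pi>\<close> times Euler's integral for \<open>\<Gamma> (- \<nu>)\<close>, and the reflection
  formula turns the product into \<open>1 / \<Gamma> (\<nu> + 1)\<close>.
\<close>

lemma hankel_mean_limit_base:
  assumes \<nu>: "-1 < \<nu>" "\<nu> < 0"
  shows "(strip_mean (hankel_kernel \<nu>) \<longlongrightarrow> rGamma (\<nu> + 1)) at_top"
proof -
  define B where "B = strip_mean (hankel_kernel \<nu>)"
  \<comment> \<open>The mean in the coordinate \<open>s = exp x\<close>, extended by its limit 0 to \<open>s = 0\<close>, so that the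
    fundamental theorem of calculus applies on closed intervals starting at 0.\<close>
  define F where "F s = (if s \<le> 0 then 0 else B (ln s))" for s
  define c where "c = - (sin (\<nu> * pi) / pi)"
  define g where "g s = s powr (- \<nu> - 1) / exp s" for s :: real
  have dB: "(B has_real_derivative c * exp (- exp x - \<nu> * x)) (at x)" for x
    unfolding B_def c_def by (rule hankel_mean_deriv)
  have dF: "(F has_real_derivative c * g s) (at s)" if "0 < s" for s
  proof -
    have "((\<lambda>s. B (ln s)) has_real_derivative c * exp (- exp (ln s) - \<nu> * ln s) * (1 / s)) (at s)"
      by (rule DERIV_chain2[OF dB]) (use that in \<open>auto intro!: derivative_eq_intros\<close>)
    moreover have "exp (- exp (ln s) - \<nu> * ln s) * (1 / s) = g s"
      using that by (simp add: g_def powr_def exp_diff exp_minus field_simps left_diff_distrib)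
    ultimately have "((\<lambda>s. B (ln s)) has_real_derivative c * g s) (at s)"
      by (simp only: mult.assoc)
    then show ?thesis
      by (rule has_field_derivative_transform_within_open[of _ _ _ "{0<..}"])
         (use that in \<open>auto simp: F_def\<close>)
  qed
  have cont0: "(F \<longlongrightarrow> 0) (at_right 0)"
  proof (rule Lim_transform_eventually)
    show "((\<lambda>s. B (ln s)) \<longlongrightarrow> 0) (at_right 0)"
      unfolding B_def by (rule filterlim_compose[OF hankel_mean_at_bot[OF \<nu>(2)] ln_at_0])
    show "\<forall>\<^sub>F s in at_right 0. B (ln s) = F s"
      unfolding eventually_at_right_field by (auto simp: F_def intro!: exI[of _ 1])
  qed
  have hasint: "((\<lambda>s. c * g s) has_integral F T) {0..T}" if T: "0 \<le> T" for T
  proof -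
    have "((\<lambda>s. c * g s) has_integral F T - F 0) {0..T}"
    proof (rule fundamental_theorem_of_calculus_interior[OF T])
      show "continuous_on {0..T} F"
        unfolding continuous_on_def
      proof
        fix s assume s: "s \<in> {0..T}"
        show "(F \<longlongrightarrow> F s) (at s within {0..T})"
        proof (cases "s = 0")
          case True
          have "at (0::real) within {0..T} \<le> at_right 0"
            unfolding at_within_def by (intro inf_mono order_refl) auto
          then show ?thesis using cont0 True by (auto simp: F_def intro: tendsto_mono)
        next
          case False
          then have "isCont F s" using s by (intro DERIV_isCont[OF dF]) auto
          then show ?thesis by (auto simp: isCont_def intro: tendsto_within_subset)
        qed
      qed
      show "(F has_vector_derivative c * g s) (at s)" if "s \<in> {0<..<T}" for s
        using dF[of s] that by (simp add: has_real_derivative_iff_has_vector_derivative)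
    qed
    then show ?thesis by (simp add: F_def)
  qed
  have intg: "(g has_integral Gamma (- \<nu>)) {0..}"
    unfolding g_def[abs_def] using Gamma_integral_real[of "- \<nu>"] \<nu> by simp
  have "g absolutely_integrable_on {0..}"
    by (rule nonnegative_absolutely_integrable_1[OF has_integral_integrable[OF intg]])
       (simp add: g_def)
  then have si: "set_integrable lebesgue {0..} (\<lambda>s. c * g s)"
    by (rule set_integrable_mult_right)
  have lim: "((\<lambda>T. LINT s:{0..T}|lebesgue. c * g s) \<longlongrightarrow> (LINT s:{0..}|lebesgue. c * g s)) at_top"
    by (rule tendsto_set_lebesgue_integral_at_top[OF _ si]) auto
  have total: "(LINT s:{0..}|lebesgue. c * g s) = c * Gamma (- \<nu>)"
    by (rule trans[OF set_lebesgue_integral_eq_integral(2)[OF si]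
          integral_unique[OF has_integral_mult_right[OF intg]]])
  have "(LINT s:{0..T}|lebesgue. c * g s) = F T" if T: "0 \<le> T" for T
  proof -
    have "set_integrable lebesgue {0..T} (\<lambda>s. c * g s)"
      by (rule set_integrable_subset[OF si]) auto
    from set_lebesgue_integral_eq_integral(2)[OF this] show ?thesis
      by (rule trans) (rule integral_unique[OF hasint[OF T]])
  qed
  then have part: "\<forall>\<^sub>F T in at_top. (LINT s:{0..T}|lebesgue. c * g s) = F T"
    by (rule eventually_mono[OF eventually_ge_at_top])
  have "(F \<longlongrightarrow> c * Gamma (- \<nu>)) at_top"
    by (rule Lim_transform_eventually[OF lim[unfolded total] part])
  from filterlim_compose[OF this exp_at_top]
  have "((\<lambda>x. F (exp x)) \<longlongrightarrow> rGamma (\<nu> + 1)) at_top"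
    unfolding c_def Gamma_reflection_neg_real[OF \<nu>] .
  moreover have "(\<lambda>x. F (exp x)) = strip_mean (hankel_kernel \<nu>)"
    by (rule ext) (simp add: F_def B_def)
  ultimately show ?thesis by (simp only:)
qed

text \<open>
  Induction on an integer bound for \<open>\<nu>\<close>: the recursion lowers the exponent by one until it lies in
  \<open>(-1, 0]\<close>.
\<close>

lemma hankel_mean_limit:
  assumes "-1 < \<nu>"
  shows "(strip_mean (hankel_kernel \<nu>) \<longlongrightarrow> rGamma (\<nu> + 1)) at_top"
proof -
  have "(strip_mean (hankel_kernel \<nu>) \<longlongrightarrow> rGamma (\<nu> + 1)) at_top"
    if "-1 < \<nu>" "\<nu> \<le> real n" for n \<nu>
    using that
  proof (induction n arbitrary: \<nu>)
    case 0
    then consider "\<nu> < 0" | "\<nu> = 0" by linarith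
    then show ?case
    proof cases
      case 1
      then show ?thesis using hankel_mean_limit_base 0 by blast
    next
      case 2
      have "strip_mean (hankel_kernel 0) = (\<lambda>_. 1)" using hankel_mean_0 by auto
      then show ?thesis using 2 by simp
    qed
  next
    case (Suc n)
    show ?case
    proof (cases "\<nu> \<le> real n")
      case True
      then show ?thesis using Suc by blast
    next
      case False
      then have \<nu>: "\<nu> > 0" by linarith
      have "(strip_mean (hankel_kernel (\<nu> - 1)) \<longlongrightarrow> rGamma (\<nu> - 1 + 1)) at_top"
        by (rule Suc.IH) (use Suc.prems \<nu> in auto)
      then have "((\<lambda>x. (strip_mean (hankel_kernel (\<nu> - 1)) x + sin (\<nu> * pi) / pi * exp (- exp x - \<nu> * x)) / \<nu>)
          \<longlongrightarrow> (rGamma (\<nu> - 1 + 1) + sin (\<nu> * pi) / pi * 0) / \<nu>) at_top"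
        by (intro tendsto_intros exp_neg_exp_lim) (use \<nu> in auto)
      moreover have "(strip_mean (hankel_kernel (\<nu> - 1)) x + sin (\<nu> * pi) / pi * exp (- exp x - \<nu> * x)) / \<nu>
          = strip_mean (hankel_kernel \<nu>) x" for x
        using hankel_mean_recursion[of \<nu> x] \<nu> by (simp add: field_simps)
      moreover have "rGamma (\<nu> - 1 + 1) / \<nu> = rGamma (\<nu> + 1)"
        using rGamma_plus1[of \<nu>] \<nu> by (simp add: field_simps)
      ultimately show ?thesis by simp
    qed
  qed
  moreover have "\<nu> \<le> real (nat \<lceil>\<nu>\<rceil>)" by linarith
  ultimately show ?thesis using assms by blast
qed

text \<open>
  The factor \<open>exp (- \<nu> y)\<close> makes this bound summable over \<open>\<nu> = a n\<close> with weights
  \<open>l ^ n\<close> once \<open>y\<close> is large; since it is uniform in \<open>x \<ge> y\<close>, it dominates the series when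
  \<open>x \<rightarrow> \<infinity>\<close>.  At \<open>x = y\<close> the kernel is bounded on the segment, and from there on the
  derivative is at most \<open>exp (- \<nu> y) * exp (- t)\<close>, whose integral over \<open>t \<ge> y\<close> is at most
  \<open>exp (- \<nu> y)\<close>.
\<close>

lemma hankel_mean_bound:
  assumes "0 \<le> \<nu>" "0 \<le> y" "y \<le> x"
  shows "\<bar>strip_mean (hankel_kernel \<nu>) x\<bar> \<le> (exp (exp y) + 1) * exp (- \<nu> * y)"
proof -
  let ?B = "strip_mean (hankel_kernel \<nu>)" and ?c = "exp (- \<nu> * y)"
  have d: "\<bar>- (sin (\<nu> * pi) / pi) * exp (- exp t - \<nu> * t)\<bar> \<le> ?c * exp (- t)" if "y \<le> t" for t
  proof -
    have "\<bar>sin (\<nu> * pi)\<bar> \<le> pi"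
      using abs_sin_le_one[of "\<nu> * pi"] pi_ge_two by linarith
    then have "\<bar>sin (\<nu> * pi) / pi\<bar> \<le> 1" by (simp only: abs_divide) simp
    moreover have "exp (- exp t - \<nu> * t) \<le> ?c * exp (- t)"
    proof -
      have "t \<le> exp t" using exp_ge_add_one_self[of t] by linarith
      moreover have "\<nu> * y \<le> \<nu> * t" using that assms by (intro mult_left_mono) auto
      ultimately show ?thesis by (simp add: exp_add[symmetric])
    qed
    ultimately show ?thesis
      unfolding abs_mult abs_minus_cancel
      using mult_mono[of "\<bar>sin (\<nu> * pi) / pi\<bar>" 1 "exp (- exp t - \<nu> * t)" "?c * exp (- t)"] by simp
  qed
  have dc: "((\<lambda>t. ?c * exp (- t)) has_real_derivative - (?c * exp (- t))) (at t)" for t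
    by (auto intro!: derivative_eq_intros)
  have up: "?B x + ?c * exp (- x) \<le> ?B y + ?c * exp (- y)"
  proof (rule DERIV_nonpos_imp_nonincreasing[OF assms(3)])
    fix t assume "y \<le> t" "t \<le> x"
    then have "- (sin (\<nu> * pi) / pi) * exp (- exp t - \<nu> * t) + - (?c * exp (- t)) \<le> 0"
      using abs_le_D1[OF d[of t]] by linarith
    then show "\<exists>D. ((\<lambda>t. ?B t + ?c * exp (- t)) has_real_derivative D) (at t) \<and> D \<le> 0"
      using DERIV_add[OF hankel_mean_deriv[of \<nu> t] dc[of t]] by blast
  qed
  have lo: "?B y - ?c * exp (- y) \<le> ?B x - ?c * exp (- x)"
  proof (rule DERIV_nonneg_imp_nondecreasing[OF assms(3)])
    fix t assume "y \<le> t" "t \<le> x"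
    then have "0 \<le> - (sin (\<nu> * pi) / pi) * exp (- exp t - \<nu> * t) - - (?c * exp (- t))"
      using abs_le_D2[OF d[of t]] by linarith
    then show "\<exists>D. ((\<lambda>t. ?B t - ?c * exp (- t)) has_real_derivative D) (at t) \<and> 0 \<le> D"
      using DERIV_diff[OF hankel_mean_deriv[of \<nu> t] dc[of t]] by blast
  qed
  have "\<bar>?B y\<bar> \<le> exp (exp y - \<nu> * y)"
    by (rule strip_mean_bound) (auto simp: norm_hankel_kernel_le continuous_intros)
  also have "\<dots> = exp (exp y) * ?c" by (simp add: exp_add[symmetric])
  finally have "\<bar>?B y\<bar> \<le> exp (exp y) * ?c" .
  moreover have "?c * exp (- y) \<le> ?c * 1" using assms by (intro mult_left_mono) auto
  moreover have "0 \<le> ?c * exp (- x)" by simp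
  moreover have "(exp (exp y) + 1) * ?c = exp (exp y) * ?c + ?c" by (simp add: algebra_simps)
  ultimately show ?thesis using up lo by linarith
qed

section \<open>The Mittag-Leffler function as a Laplace transform\<close>

text \<open>
  The function \<open>exp (r w) * w powr a / (w powr a + l)\<close> in the coordinate \<open>w = exp z\<close>; it is
  \<open>w * exp (r w)\<close> times \<open>w powr (a - 1) / (w powr a + l)\<close>, which is the Laplace transform of the
  function \<open>r \<mapsto> E\<^sub>a(- l r\<^sup>a)\<close>.
\<close>

definition ml_kernel :: "real \<Rightarrow> real \<Rightarrow> real \<Rightarrow> complex \<Rightarrow> complex" where
  "ml_kernel a l r z = exp (of_real r * exp z) * (exp (of_real a * z) / (exp (of_real a * z) + of_real l))"

definition ml_density :: "real \<Rightarrow> real \<Rightarrow> real \<Rightarrow> real" where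
  "ml_density a l s = s powr (a - 1) / pi *
     (sin (a * pi) / (inverse l * s powr (2 * a) + 2 * s powr a * cos (a * pi) + l))"

text \<open>
  Here \<open>a < 1\<close> enters: in the closed strip the argument of \<open>exp (a z)\<close> stays strictly between
  \<open>- \<pi>\<close> and \<open>\<pi>\<close>, so \<open>exp (a z)\<close> cannot hit the negative number \<open>- l\<close>.
\<close>

lemma ml_denominator_nonzero:
  assumes "0 < a" "a < 1" "0 < l" "\<bar>Im z\<bar> \<le> pi"
  shows "exp (of_real a * z) + of_real l \<noteq> 0"
proof
  assume 0: "exp (of_real a * z) + of_real l = 0"
  have "\<bar>a * Im z\<bar> \<le> a * pi" using assms by (simp add: abs_mult)
  also have "a * pi < 1 * pi" using assms by (intro mult_strict_right_mono) auto
  finally have b: "\<bar>a * Im z\<bar> < pi" by simp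
  from arg_cong[OF 0, of Im] have s: "sin (a * Im z) = 0" by (simp add: Im_exp)
  have "a * Im z = 0"
  proof (rule ccontr)
    assume "a * Im z \<noteq> 0"
    then consider "0 < a * Im z" "a * Im z < pi" | "0 < - (a * Im z)" "- (a * Im z) < pi"
      using b by linarith
    then show False
      using sin_gt_zero[of "a * Im z"] sin_gt_zero[of "- (a * Im z)"] s by cases auto
  qed
  then have "Re (exp (of_real a * z)) > 0" by (auto simp: Re_exp)
  with arg_cong[OF 0, of Re] assms(3) show False by simp
qed

lemma ml_kernel_deriv:
  assumes "0 < a" "a < 1" "0 < l"
  shows "\<exists>K'. (\<forall>z. \<bar>Im z\<bar> \<le> pi \<longrightarrow> (ml_kernel a l r has_field_derivative K' z) (at z))
            \<and> continuous_on {z. \<bar>Im z\<bar> \<le> pi} K'"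
proof -
  let ?u = "\<lambda>z. exp (of_real a * z)" and ?v = "\<lambda>z. exp (of_real r * exp z)"
  let ?K' = "\<lambda>z. (?v z * (of_real r * exp z)) * (?u z / (?u z + of_real l)) +
     ?v z * (((?u z * of_real a) * (?u z + of_real l) - ?u z * (?u z * of_real a)) /
       ((?u z + of_real l) * (?u z + of_real l)))"
  have "(ml_kernel a l r has_field_derivative ?K' z) (at z)" if "\<bar>Im z\<bar> \<le> pi" for z
  proof -
    note nz = ml_denominator_nonzero[OF assms that]
    have dv: "(?v has_field_derivative ?v z * (of_real r * exp z)) (at z)"
      by (auto intro!: derivative_eq_intros)
    have du: "(?u has_field_derivative ?u z * of_real a) (at z)"
      by (auto intro!: derivative_eq_intros)
    have du': "((\<lambda>z. ?u z + of_real l) has_field_derivative ?u z * of_real a) (at z)"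
      using DERIV_add[OF du DERIV_const[of "of_real l"]] by simp
    show ?thesis
      unfolding ml_kernel_def[abs_def]
      using DERIV_mult[OF dv DERIV_divide[OF du du' nz]] by (simp only: add.commute mult.commute)
  qed
  moreover have "continuous_on {z. \<bar>Im z\<bar> \<le> pi} ?K'"
    by (intro continuous_intros) (use ml_denominator_nonzero[OF assms] in auto)
  ultimately show ?thesis by (intro exI[of _ ?K'] conjI allI impI)
qed

lemma continuous_on_ml_kernel:
  assumes "0 < a" "a < 1" "0 < l"
  shows "continuous_on {z. \<bar>Im z\<bar> \<le> pi} (ml_kernel a l r)"
  unfolding ml_kernel_def
  by (intro continuous_intros) (use ml_denominator_nonzero[OF assms] in auto)

lemma ml_kernel_cnj: "ml_kernel a l r (cnj z) = cnj (ml_kernel a l r z)"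
  by (simp add: ml_kernel_def exp_cnj)

text \<open>
  Since \<open>cos (a\<pi>) > -1\<close>, the expression is at least \<open>(t powr a - l)\<^sup>2 / l\<close>.
\<close>

lemma ml_denominator_pos:
  assumes "0 < a" "a < 1" "0 < l"
  shows "0 < inverse l * (t powr a)\<^sup>2 + 2 * t powr a * cos (a * pi) + l"
proof -
  have "0 < a * pi" "a * pi < pi" using assms by auto
  then have "\<bar>cos (a * pi)\<bar> < 1"
    using sin_gt_zero[of "a * pi"] sin_cos_squared_add[of "a * pi"]
    by (metis abs_square_less_1 add.commute less_add_same_cancel1 zero_less_power)
  then have c: "cos (a * pi) > -1" by linarith
  show ?thesis
  proof (cases "t powr a = 0")
    case False
    then have t: "t powr a > 0" by (simp add: powr_ge_zero less_le)
    have "2 * t powr a * (-1) < 2 * t powr a * cos (a * pi)"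
      using t c by (intro mult_strict_left_mono) auto
    moreover have "inverse l * (t powr a)\<^sup>2 - 2 * t powr a + l = inverse l * (t powr a - l)\<^sup>2"
      using assms by (simp add: power2_eq_square field_simps)
    moreover have "0 \<le> inverse l * (t powr a - l)\<^sup>2" using assms by simp
    ultimately show ?thesis by linarith
  qed (use assms in auto)
qed

text \<open>
  The jump across the cut.  With \<open>u = exp (a (x + \<i>\<pi>))\<close> one has
  \<open>Im (u / (u + l)) = l * Im u / \<bar>u + l\<bar>\<^sup>2\<close>, and \<open>exp (r * exp (x + \<i>\<pi>)) = exp (- r * exp x)\<close>
  is the Laplace weight.
\<close>

lemma Im_ml_kernel_pi:
  assumes "0 < a" "a < 1" "0 < l"
  shows "Im (ml_kernel a l r (Complex x pi)) / pi
          = exp (- r * exp x) * (ml_density a l (exp x) * exp x)"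
proof -
  define t where "t = exp (a * x)"
  define c where "c = cos (a * pi)"
  define s where "s = sin (a * pi)"
  have t: "t > 0" by (simp add: t_def)
  have cs: "c\<^sup>2 + s\<^sup>2 = 1" by (simp add: c_def s_def)
  have tp: "exp x powr a = t" by (simp add: t_def powr_def)
  have u: "exp (of_real a * Complex x pi) = Complex (t * c) (t * s)"
    by (simp add: complex_eq_iff Re_exp Im_exp t_def c_def s_def)
  have v: "exp (of_real r * exp (Complex x pi)) = of_real (exp (- r * exp x))"
    by (simp add: complex_eq_iff Re_exp Im_exp)
  have D: "inverse l * t\<^sup>2 + 2 * t * c + l > 0"
    using ml_denominator_pos[OF assms, of "exp x"] by (simp add: tp c_def)
  have q: "(t * c + l)\<^sup>2 + (t * s)\<^sup>2 = l * (inverse l * t\<^sup>2 + 2 * t * c + l)"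
  proof -
    have "(t * c + l)\<^sup>2 + (t * s)\<^sup>2 = t\<^sup>2 * (c\<^sup>2 + s\<^sup>2) + 2 * t * c * l + l\<^sup>2"
      by (simp add: power2_eq_square algebra_simps)
    also have "\<dots> = l * (inverse l * t\<^sup>2 + 2 * t * c + l)"
      unfolding cs using assms by (simp add: distrib_left power2_eq_square mult.assoc[symmetric])
    finally show ?thesis .
  qed
  have "Im (Complex (t * c) (t * s) / (Complex (t * c) (t * s) + of_real l))
      = (t * s * (t * c + l) - t * c * (t * s)) / ((t * c + l)\<^sup>2 + (t * s)\<^sup>2)"
    by (simp add: Im_divide)
  also have "\<dots> = (l * (t * s)) / (l * (inverse l * t\<^sup>2 + 2 * t * c + l))"
    unfolding q by (simp add: algebra_simps)
  also have "\<dots> = t * s / (inverse l * t\<^sup>2 + 2 * t * c + l)"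
    using assms by simp
  finally have I: "Im (Complex (t * c) (t * s) / (Complex (t * c) (t * s) + of_real l))
      = t * s / (inverse l * t\<^sup>2 + 2 * t * c + l)" .
  have "exp x powr (2 * a) = t\<^sup>2"
    by (simp only: tp[symmetric] mult_2 powr_add power2_eq_square)
  moreover have "exp x powr (a - 1) * exp x = t"
    by (simp add: t_def powr_def exp_add[symmetric] algebra_simps)
  ultimately have L: "ml_density a l (exp x) * exp x = t * s / (inverse l * t\<^sup>2 + 2 * t * c + l) / pi"
    unfolding ml_density_def tp c_def[symmetric] s_def[symmetric] by (simp add: mult.commute mult.left_commute)
  have M: "Im (of_real e * w) = e * Im w" for e w by simp
  show ?thesis
    unfolding ml_kernel_def u v M I L by simp
qed

lemma ml_density_nonneg:
  assumes "0 < a" "a < 1" "0 < l"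
  shows "0 \<le> ml_density a l s"
proof -
  have "s powr (2 * a) = (s powr a)\<^sup>2" by (simp only: mult_2 powr_add power2_eq_square)
  moreover have "0 \<le> sin (a * pi)" using assms by (intro sin_ge_zero) auto
  ultimately show ?thesis
    using less_imp_le[OF ml_denominator_pos[OF assms, of s]] by (simp add: ml_density_def)
qed

lemma norm_ml_denominator_ge:
  assumes "0 < l"
  shows "\<bar>exp (a * x) - l\<bar> \<le> norm (exp (of_real a * Complex x y) + of_real l)"
proof -
  have "\<bar>norm (exp (of_real a * Complex x y)) - norm (- complex_of_real l)\<bar>
     \<le> norm (exp (of_real a * Complex x y) - (- of_real l))"
    by (rule norm_triangle_ineq3)
  then show ?thesis using assms by simp
qed

lemma ml_mean_at_bot:
  assumes "0 < a" "a < 1" "0 < l" "0 \<le> r"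
  shows "(strip_mean (ml_kernel a l r) \<longlongrightarrow> 0) at_bot"
proof (rule strip_mean_tendsto)
  fix e :: real assume e: "0 < e"
  have "((\<lambda>x. exp (r * exp x) * (exp (a * x) / (l - exp (a * x)))) \<longlongrightarrow> 0) at_bot"
    using assms by real_asymp
  from order_tendstoD(2)[OF this e]
  have 1: "\<forall>\<^sub>F x in at_bot. exp (r * exp x) * (exp (a * x) / (l - exp (a * x))) < e" .
  have "((\<lambda>x. exp (a * x)) \<longlongrightarrow> 0) at_bot" using assms by real_asymp
  from order_tendstoD(2)[OF this assms(3)] have 2: "\<forall>\<^sub>F x in at_bot. exp (a * x) < l" .
  from 1 2 show "\<forall>\<^sub>F x in at_bot. \<forall>y. \<bar>y\<bar> \<le> pi \<longrightarrow> norm (ml_kernel a l r (Complex x y) - of_real 0) \<le> e"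
  proof eventually_elim
    case (elim x)
    show ?case
    proof (intro allI impI)
      fix y :: real
      have "exp (r * (exp x * cos y)) \<le> exp (r * exp x)"
        using assms mult_left_mono[of "exp x * cos y" "exp x" r] by simp
      moreover have "exp (a * x) / norm (exp (of_real a * Complex x y) + of_real l) \<le> exp (a * x) / (l - exp (a * x))"
        using elim norm_ml_denominator_ge[OF assms(3), of a x y] by (intro divide_left_mono) (auto intro!: mult_pos_pos)
      ultimately have "norm (ml_kernel a l r (Complex x y)) \<le> exp (r * exp x) * (exp (a * x) / (l - exp (a * x)))"
        unfolding ml_kernel_def norm_mult norm_divide by (intro mult_mono) (auto simp: Re_exp)
      with elim show "norm (ml_kernel a l r (Complex x y) - of_real 0) \<le> e" by simp
    qed
  qed
qed (rule continuous_on_ml_kernel[OF assms(1-3)])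

text \<open>
  The case \<open>r = 0\<close> gives the total mass of \<open>ml_density\<close>.  It is treated separately because the
  kernel then tends to 1 directly, whereas for \<open>r > 0\<close> it does not converge on the segment.
\<close>

lemma ml_mean_at_top_zero:
  assumes "0 < a" "a < 1" "0 < l"
  shows "(strip_mean (ml_kernel a l 0) \<longlongrightarrow> 1) at_top"
proof (rule strip_mean_tendsto)
  fix e :: real assume e: "0 < e"
  have "((\<lambda>x. l / (exp (a * x) - l)) \<longlongrightarrow> 0) at_top"
    using assms by real_asymp
  from order_tendstoD(2)[OF this e]
  have 1: "\<forall>\<^sub>F x in at_top. l / (exp (a * x) - l) < e" .
  have "filterlim (\<lambda>x. exp (a * x)) at_top at_top" using assms by real_asymp
  then have 2: "\<forall>\<^sub>F x in at_top. l < exp (a * x)" by (simp add: filterlim_at_top_dense)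
  from 1 2 show "\<forall>\<^sub>F x in at_top. \<forall>y. \<bar>y\<bar> \<le> pi \<longrightarrow> norm (ml_kernel a l 0 (Complex x y) - of_real 1) \<le> e"
  proof eventually_elim
    case (elim x)
    show ?case
    proof (intro allI impI)
      fix y :: real assume y: "\<bar>y\<bar> \<le> pi"
      have "ml_kernel a l 0 (Complex x y) - of_real 1 = - of_real l / (exp (of_real a * Complex x y) + of_real l)"
        using ml_denominator_nonzero[OF assms, of "Complex x y"] y
        by (simp add: ml_kernel_def divide_simps)
      moreover have "l / norm (exp (of_real a * Complex x y) + of_real l) \<le> l / (exp (a * x) - l)"
        using elim assms norm_ml_denominator_ge[OF assms(3), of a x y]
        by (intro divide_left_mono) (auto intro!: mult_pos_pos)
      ultimately show "norm (ml_kernel a l 0 (Complex x y) - of_real 1) \<le> e"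
        using elim assms by (simp add: norm_divide)
    qed
  qed
qed (rule continuous_on_ml_kernel[OF assms])

text \<open>
  On a segment far enough to the right, \<open>u / (u + l)\<close> with \<open>u = exp (a z)\<close> is a geometric series in
  \<open>- l / u\<close> that converges uniformly, and the terms are Hankel kernels with exponents \<open>a n\<close>.
\<close>

lemma ml_mean_sums:
  assumes al: "0 < a" "a < 1" "0 < l" and x: "l * exp (- a * x) < 1"
  shows "(\<lambda>n. (- l) ^ n * strip_mean (hankel_kernel (a * real n)) x) sums strip_mean (ml_kernel a l 1) x"
proof -
  define \<rho> where "\<rho> = l * exp (- a * x)"
  have \<rho>: "0 \<le> \<rho>" "\<rho> < 1" using assms by (auto simp: \<rho>_def)
  let ?R = "\<lambda>N z. ml_kernel a l 1 z - (\<Sum>n<N. of_real ((- l) ^ n) * hankel_kernel (a * real n) z)"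
  have contR: "continuous_on {z. \<bar>Im z\<bar> \<le> pi} (?R N)" for N
    by (intro continuous_intros continuous_on_ml_kernel al)
  have bound: "norm (?R N (Complex x y)) \<le> exp (exp x) * (\<rho> ^ N / (1 - \<rho>))" if y: "\<bar>y\<bar> \<le> pi" for N y
  proof -
    define z where "z = Complex x y"
    define E where "E = exp (exp z)"
    define u where "u = exp (of_real a * z)"
    define q where "q = - of_real l / u"
    have u0: "u \<noteq> 0" by (simp add: u_def)
    have nq: "norm q = \<rho>"
      using al by (simp add: q_def u_def z_def norm_divide norm_mult norm_inverse \<rho>_def exp_minus divide_inverse)
    then have q1: "q \<noteq> 1" using \<rho> by auto
    have "of_real ((- l) ^ n) * hankel_kernel (a * real n) z = E * q ^ n" for n
    proof -
      have "exp (exp z - of_real (a * real n) * z) = E / u ^ n"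
        by (simp add: E_def u_def exp_diff exp_of_nat_mult[symmetric] mult.assoc mult.left_commute)
      then show ?thesis
        by (simp only: hankel_kernel_def q_def power_divide of_real_power of_real_minus
            times_divide_eq_right mult.commute)
    qed
    then have "(\<Sum>n<N. of_real ((- l) ^ n) * hankel_kernel (a * real n) z) = E * ((1 - q ^ N) / (1 - q))"
      using q1 by (simp add: sum_distrib_left[symmetric] sum_gp_strict)
    moreover have "ml_kernel a l 1 z = E * (1 / (1 - q))"
    proof -
      have "u + of_real l \<noteq> 0" unfolding u_def using ml_denominator_nonzero[OF al, of z] y
        by (simp add: z_def)
      moreover have "1 - q = (u + of_real l) / u" using u0 by (simp add: q_def field_simps)
      ultimately show ?thesis by (simp add: ml_kernel_def E_def u_def)
    qed
    ultimately have "?R N z = E * (1 / (1 - q)) - E * ((1 - q ^ N) / (1 - q))" by (simp only:)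
    also have "\<dots> = E * (q ^ N / (1 - q))"
      by (simp only: right_diff_distrib[symmetric] diff_divide_distrib[symmetric]) simp
    finally have "norm (?R N z) = norm E * (\<rho> ^ N / norm (1 - q))"
      by (simp only: norm_mult norm_divide norm_power nq)
    also have "\<dots> \<le> exp (exp x) * (\<rho> ^ N / (1 - \<rho>))"
    proof (intro mult_mono divide_left_mono)
      show "norm E \<le> exp (exp x)" by (simp add: E_def z_def Re_exp)
      show le: "1 - \<rho> \<le> norm (1 - q)" using norm_triangle_ineq2[of 1 q] nq by simp
      show "0 < norm (1 - q) * (1 - \<rho>)" using le \<rho> by (intro mult_pos_pos) linarith+
    qed (use \<rho> in auto)
    finally show ?thesis by (simp only: z_def)
  qed
  have "(\<lambda>N. strip_mean (?R N) x) \<longlonglongrightarrow> 0"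
  proof (rule Lim_null_comparison)
    show "\<forall>\<^sub>F N in sequentially. norm (strip_mean (?R N) x) \<le> exp (exp x) * (\<rho> ^ N / (1 - \<rho>))"
      using strip_mean_bound[OF contR bound] by (intro always_eventually allI) (simp only: real_norm_def)
    have "(\<lambda>N. exp (exp x) * (\<rho> ^ N / (1 - \<rho>))) \<longlonglongrightarrow> exp (exp x) * (0 / (1 - \<rho>))"
      using \<rho> by (intro tendsto_intros LIMSEQ_power_zero) auto
    then show "(\<lambda>N. exp (exp x) * (\<rho> ^ N / (1 - \<rho>))) \<longlonglongrightarrow> 0" by simp
  qed
  then have "(\<lambda>N. strip_mean (ml_kernel a l 1) x - (\<Sum>n<N. (- l) ^ n * strip_mean (hankel_kernel (a * real n)) x)) \<longlonglongrightarrow> 0"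
    by (subst (asm) strip_mean_diff_sum) (auto intro: continuous_on_ml_kernel al continuous_on_hankel_kernel)
  from tendsto_diff[OF tendsto_const[of "strip_mean (ml_kernel a l 1) x"] this]
  show ?thesis by (simp add: sums_def)
qed

text \<open>
  Tannery's theorem applied to the previous series, with Hankel's formula for each term.
\<close>

lemma ml_mean_at_top_unit:
  assumes al: "0 < a" "a < 1" "0 < l"
  shows "(strip_mean (ml_kernel a l 1) \<longlongrightarrow> mittag_leffler a (- l)) at_top"
proof -
  \<comment> \<open>Chosen so that \<open>l * exp (- a y) \<le> 1/2\<close>; the dominating series is then geometric with ratio \<open>1/2\<close>.\<close>
  define y where "y = max 0 (ln (2 * l) / a)"
  define C where "C = exp (exp y) + 1"
  have "ln (2 * l) \<le> a * y" using al by (simp add: y_def max_def field_simps)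
  then have "exp (ln (2 * l)) \<le> exp (a * y)" by simp
  then have "2 * l \<le> exp (a * y)" using al by simp
  then have half: "l * exp (- a * y) \<le> 1 / 2"
    by (simp add: exp_minus field_simps)
  have y0: "0 \<le> y" by (simp add: y_def)
  have bound: "norm ((- l) ^ n * strip_mean (hankel_kernel (a * real n)) x) \<le> C * (1 / 2) ^ n" if "y \<le> x" for n x
  proof -
    have "\<bar>strip_mean (hankel_kernel (a * real n)) x\<bar> \<le> C * exp (- (a * real n) * y)"
      unfolding C_def by (rule hankel_mean_bound) (use al y0 that in auto)
    also have "exp (- (a * real n) * y) = exp (- a * y) ^ n"
      by (simp add: exp_of_nat_mult[symmetric] mult.assoc mult.left_commute)
    finally have "l ^ n * \<bar>strip_mean (hankel_kernel (a * real n)) x\<bar> \<le> l ^ n * (C * exp (- a * y) ^ n)"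
      using al by (intro mult_left_mono) auto
    also have "\<dots> = C * (l * exp (- a * y)) ^ n" by (simp only: power_mult_distrib mult.left_commute)
    also have "\<dots> \<le> C * (1 / 2) ^ n"
      using half al by (intro mult_left_mono power_mono) (auto simp: C_def add_nonneg_nonneg)
    finally show ?thesis using al by (simp add: abs_mult power_abs)
  qed
  have "((\<lambda>x. \<Sum>n. (- l) ^ n * strip_mean (hankel_kernel (a * real n)) x) \<longlongrightarrow>
      (\<Sum>n. (- l) ^ n * rGamma (a * real n + 1))) at_top"
  proof (rule conjunct2[OF conjunct2[OF tannerys_theorem]])
    show "((\<lambda>x. (- l) ^ n * strip_mean (hankel_kernel (a * real n)) x) \<longlongrightarrow> (- l) ^ n * rGamma (a * real n + 1)) at_top" for n
    proof (intro tendsto_mult_left hankel_mean_limit)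
      have "0 \<le> a * real n" using al by simp
      then show "- 1 < a * real n" by linarith
    qed
    show "\<forall>\<^sub>F (n, x) in at_top \<times>\<^sub>F at_top. norm ((- l) ^ n * strip_mean (hankel_kernel (a * real n)) x) \<le> C * (1 / 2) ^ n"
      unfolding eventually_prod_filter
      by (intro exI[of _ "\<lambda>_. True"] exI[of _ "\<lambda>x. y \<le> x"]) (use bound in \<open>auto simp: eventually_ge_at_top\<close>)
    show "summable (\<lambda>n. C * (1 / 2) ^ n)" by (intro summable_mult summable_geometric) simp
  qed simp
  moreover have "\<forall>\<^sub>F x in at_top. (\<Sum>n. (- l) ^ n * strip_mean (hankel_kernel (a * real n)) x) = strip_mean (ml_kernel a l 1) x"
  proof (rule eventually_mono[OF eventually_ge_at_top[of y]])
    fix x assume "y \<le> x"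
    then have "l * exp (- a * x) \<le> l * exp (- a * y)" using al by (intro mult_left_mono) auto
    then have "l * exp (- a * x) < 1" using half by linarith
    from sums_unique[OF ml_mean_sums[OF al this]]
    show "(\<Sum>n. (- l) ^ n * strip_mean (hankel_kernel (a * real n)) x) = strip_mean (ml_kernel a l 1) x" by simp
  qed
  ultimately have "(strip_mean (ml_kernel a l 1) \<longlongrightarrow> (\<Sum>n. (- l) ^ n * rGamma (a * real n + 1))) at_top"
    by (rule Lim_transform_eventually)
  then show ?thesis
    by (simp add: mittag_leffler_def rGamma_inverse_Gamma divide_inverse)
qed

text \<open>
  A positive \<open>r\<close> amounts to the translation \<open>z \<mapsto> z + ln r\<close>, which replaces \<open>r\<close> by 1
  and \<open>l\<close> by \<open>l r\<^sup>a\<close>.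
\<close>

lemma ml_mean_scale:
  assumes r: "0 < r"
  shows "strip_mean (ml_kernel a l r) x = strip_mean (ml_kernel a (l * r powr a) 1) (x + ln r)"
proof -
  have "ml_kernel a (l * r powr a) 1 (Complex (x + ln r) y) = ml_kernel a l r (Complex x y)" for y
  proof -
    define z where "z = Complex x y"
    have z: "Complex (x + ln r) y = z + of_real (ln r)" by (simp add: z_def complex_eq_iff)
    have "exp (of_real (ln r)) = complex_of_real r" using r by (simp add: exp_of_real)
    then have 1: "exp (z + of_real (ln r)) = of_real r * exp z" by (simp add: exp_add)
    have "exp (of_real a * of_real (ln r)) = complex_of_real (r powr a)"
      using r by (simp add: powr_def exp_of_real[symmetric])
    then have 2: "exp (of_real a * (z + of_real (ln r))) = of_real (r powr a) * exp (of_real a * z)"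
      by (simp add: exp_add distrib_left)
    have 3: "of_real (r powr a) * exp (of_real a * z) / (of_real (r powr a) * exp (of_real a * z) + of_real (l * r powr a))
       = exp (of_real a * z) / (exp (of_real a * z) + of_real l)"
    proof -
      have "of_real (r powr a) * exp (of_real a * z) + of_real (l * r powr a)
        = of_real (r powr a) * (exp (of_real a * z) + of_real l)"
        by (simp add: distrib_left)
      then show ?thesis using r by simp
    qed
    show ?thesis
      by (simp only: ml_kernel_def z_def[symmetric] z 1 2 3 of_real_1 mult_1)
  qed
  then show ?thesis by (simp add: strip_mean_def)
qed

lemma ml_mean_at_top:
  assumes al: "0 < a" "a < 1" "0 < l" and r: "0 < r"
  shows "(strip_mean (ml_kernel a l r) \<longlongrightarrow> mittag_leffler a (- l * r powr a)) at_top"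
proof -
  have "(strip_mean (ml_kernel a (l * r powr a) 1) \<longlongrightarrow> mittag_leffler a (- (l * r powr a))) at_top"
    by (rule ml_mean_at_top_unit) (use al r in auto)
  moreover have "filterlim (\<lambda>x. x + ln r) at_top at_top"
    by (subst add.commute) (rule filterlim_tendsto_add_at_top[OF tendsto_const filterlim_ident])
  ultimately have "((\<lambda>x. strip_mean (ml_kernel a (l * r powr a) 1) (x + ln r)) \<longlongrightarrow> mittag_leffler a (- (l * r powr a))) at_top"
    by (rule filterlim_compose)
  then show ?thesis by (simp add: ml_mean_scale[OF r, symmetric])
qed

text \<open>
  In the variable \<open>s = exp x\<close> the mean is an antiderivative of the nonnegative integrand
  \<open>exp (- r s) * ml_density a l s\<close>, so its limits at both ends yield integrability and the value of
  the integral at once.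
\<close>

lemma ml_density_laplace_limit:
  assumes al: "0 < a" "a < 1" "0 < l" and r: "0 \<le> r"
    and lim: "(strip_mean (ml_kernel a l r) \<longlongrightarrow> L) at_top"
  shows "has_bochner_integral lborel (\<lambda>s. indicator {0<..} s * (exp (- r * s) * ml_density a l s)) L"
proof -
  let ?f = "\<lambda>s. exp (- r * s) * ml_density a l s"
  let ?F = "\<lambda>s. strip_mean (ml_kernel a l r) (ln s)"
  have F: "(?F has_real_derivative ?f s) (at s)" if "0 < s" for s
  proof -
    obtain K' where K': "\<And>z. \<bar>Im z\<bar> \<le> pi \<Longrightarrow> (ml_kernel a l r has_field_derivative K' z) (at z)"
        "continuous_on {z. \<bar>Im z\<bar> \<le> pi} K'"
      using ml_kernel_deriv[OF al] by blast
    have "(?F has_real_derivative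
        Im (ml_kernel a l r (Complex (ln s) pi)) / pi * (1 / s)) (at s)"
      by (rule DERIV_chain2[OF strip_mean_has_derivative[OF K' ml_kernel_cnj] DERIV_ln_divide[OF that]])
    then show ?thesis unfolding Im_ml_kernel_pi[OF al] using that by simp
  qed
  have cont: "isCont ?f s" if "0 < s" for s
  proof -
    have "inverse l * s powr (2 * a) + 2 * s powr a * cos (a * pi) + l \<noteq> 0"
      using ml_denominator_pos[OF al, of s]
      by (simp only: mult_2 powr_add power2_eq_square)
    then show ?thesis
      unfolding ml_density_def using that by (intro continuous_intros) auto
  qed
  have A: "((?F \<circ> real_of_ereal) \<longlongrightarrow> 0) (at_right 0)"
  proof -
    have "(?F \<longlongrightarrow> 0) (at_right 0)"
      by (rule filterlim_compose[OF ml_mean_at_bot[OF al r] ln_at_0])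
    then show ?thesis unfolding zero_ereal_def ereal_tendsto_simps .
  qed
  have B: "((?F \<circ> real_of_ereal) \<longlongrightarrow> L) (at_left \<infinity>)"
    unfolding ereal_tendsto_simps
    by (rule filterlim_compose[OF lim ln_at_top])
  have nn: "0 \<le> ?f s" for s using ml_density_nonneg[OF al, of s] by simp
  note FTC = interval_integral_FTC_nonneg[of 0 \<infinity> ?F ?f 0 L, OF _ F cont _ A B]
  have E: "einterval 0 \<infinity> = {0::real<..}" by (auto simp: einterval_def)
  have "set_integrable lborel {0<..} ?f"
    using FTC(1) nn E by simp
  moreover have "(LBINT s:{0<..}. ?f s) = L"
    using FTC(2) nn E by (simp add: interval_lebesgue_integral_def)
  ultimately show ?thesis
    unfolding set_integrable_def set_lebesgue_integral_def
    by (auto simp: has_bochner_integral_iff)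
qed

text \<open>
  Tempering by \<open>exp (- \<theta> r)\<close> on the Laplace side is translation by \<open>\<theta>\<close>.
\<close>

definition tempered_density :: "real \<Rightarrow> real \<Rightarrow> real \<Rightarrow> real \<Rightarrow> real" where
  "tempered_density a l \<theta> x = ml_density a l (x - \<theta>) * indicator {\<theta><..} x"

lemma ml_density_measurable [measurable]: "ml_density a l \<in> borel_measurable borel"
  unfolding ml_density_def[abs_def] by measurable

lemma tempered_density_measurable [measurable]: "tempered_density a l \<theta> \<in> borel_measurable borel"
  unfolding tempered_density_def[abs_def] by measurable

lemma tempered_density_nonneg:
  assumes "0 < a" "a < 1" "0 < l"
  shows "0 \<le> tempered_density a l \<theta> x"
  using ml_density_nonneg[OF assms] by (simp add: tempered_density_def)

lemma tempered_density_laplace: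
  assumes al: "0 < a" "a < 1" "0 < l" and \<theta>: "0 \<le> \<theta>"
  shows "represents_laplace (density lborel (\<lambda>x. ennreal (tempered_density a l \<theta> x)))
           (\<lambda>r. exp (- \<theta> * r) * mittag_leffler a (- l * r powr a))"
proof -
  let ?g = "tempered_density a l \<theta>"
  let ?P = "density lborel (\<lambda>x. ennreal (?g x))"
  have shift: "has_bochner_integral lborel (\<lambda>x. ?g x * exp (- r * x)) (exp (- \<theta> * r) * L)"
    if r: "0 \<le> r" and L: "(strip_mean (ml_kernel a l r) \<longlongrightarrow> L) at_top" for r L
  proof -
    have "has_bochner_integral lborel
        (\<lambda>x. indicator {0<..} (- \<theta> + 1 * x) * (exp (- r * (- \<theta> + 1 * x)) * ml_density a l (- \<theta> + 1 * x))) (L /\<^sub>R \<bar>1\<bar>)"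
      using ml_density_laplace_limit[OF al r L]
      by (subst (asm) lborel_has_bochner_integral_real_affine_iff[of 1 _ _ "- \<theta>"]) auto
    from has_bochner_integral_mult_right[OF this, of "exp (- \<theta> * r)"]
    have "has_bochner_integral lborel (\<lambda>x. exp (- \<theta> * r) *
        (indicator {0<..} (- \<theta> + 1 * x) * (exp (- r * (- \<theta> + 1 * x)) * ml_density a l (- \<theta> + 1 * x)))) (exp (- \<theta> * r) * L)"
      by simp
    also have "(\<lambda>x. exp (- \<theta> * r) *
        (indicator {0<..} (- \<theta> + 1 * x) * (exp (- r * (- \<theta> + 1 * x)) * ml_density a l (- \<theta> + 1 * x)))) = (\<lambda>x. ?g x * exp (- r * x))"
    proof
      fix x
      have "exp (- \<theta> * r) * exp (- r * (- \<theta> + 1 * x)) = exp (- r * x)"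
        by (simp add: exp_add[symmetric] algebra_simps)
      moreover have "indicator {0<..} (- \<theta> + 1 * x) = (indicator {\<theta><..} x :: real)"
        by (auto simp: indicator_def)
      moreover have "ml_density a l (- \<theta> + 1 * x) = ml_density a l (x - \<theta>)" by simp
      ultimately show "exp (- \<theta> * r) *
        (indicator {0<..} (- \<theta> + 1 * x) * (exp (- r * (- \<theta> + 1 * x)) * ml_density a l (- \<theta> + 1 * x))) = ?g x * exp (- r * x)"
        unfolding tempered_density_def by (metis mult.assoc mult.commute)
    qed
    finally show ?thesis .
  qed
  have "has_bochner_integral lborel ?g 1"
    using shift[of 0 1, OF _ ml_mean_at_top_zero[OF al]] by simp
  then have "(\<integral>\<^sup>+ x. ennreal (?g x) \<partial>lborel) = 1"
    using nn_integral_eq_integral[of lborel ?g] tempered_density_nonneg[OF al]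
    by (simp add: has_bochner_integral_iff)
  then have "prob_space ?P"
    by (intro prob_spaceI) (simp add: emeasure_density)
  then have "real_distribution ?P"
    by (simp add: real_distribution_def real_distribution_axioms_def)
  moreover have "AE s in ?P. 0 \<le> s"
    by (subst AE_density) (use \<theta> in \<open>auto simp: tempered_density_def indicator_def intro!: AE_I2\<close>)
  moreover have "exp (- \<theta> * r) * mittag_leffler a (- l * r powr a) = (\<integral>s. exp (- r * s) \<partial>?P)" if "0 < r" for r
  proof -
    have "(\<integral>s. exp (- r * s) \<partial>?P) = (\<integral>s. ?g s * exp (- r * s) \<partial>lborel)"
      by (subst integral_density) (auto simp: tempered_density_nonneg[OF al])
    then show ?thesis
      using shift[OF _ ml_mean_at_top[OF al that]] that by (simp add: has_bochner_integral_iff)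
  qed
  ultimately show ?thesis unfolding represents_laplace_def by blast
qed

section \<open>Uniqueness of the representing measure\<close>

text \<open>
  The image of the measure under \<open>s \<mapsto> exp (- s)\<close> is concentrated on \<open>(0, 1]\<close>, so its characteristic
  function is the sum of its moment series, and its \<open>n\<close>-th moment is the Laplace transform at \<open>n\<close>.
  The moment of order 0 is listed apart, since \<open>f\<close> is prescribed only at positive arguments.
\<close>

lemma char_exp_uminus_eq_laplace_series:
  assumes P: "represents_laplace P f"
  shows "char (distr P borel (\<lambda>s. exp (- s))) t
    = (\<Sum>n. (\<i> * of_real t) ^ n / fact n * of_real (if n = 0 then 1 else f (real n)))"
proof -
  interpret real_distribution P using P by (simp add: represents_laplace_def)
  have pos: "AE s in P. 0 \<le> s" and f: "\<And>r. 0 < r \<Longrightarrow> f r = (\<integral>s. exp (- r * s) \<partial>P)"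
    using P by (auto simp: represents_laplace_def)
  define g where "g n s = (\<i> * of_real t) ^ n / fact n * complex_of_real (exp (- real n * s))" for n :: nat and s :: real
  have ng: "norm (g n s) = \<bar>t\<bar> ^ n / fact n * exp (- real n * s)" for n s
    by (simp add: g_def norm_mult norm_divide norm_power)
  have le: "AE s in P. norm (g n s) \<le> \<bar>t\<bar> ^ n / fact n" for n
    using pos
  proof eventually_elim
    case (elim s)
    have "\<bar>t\<bar> ^ n / fact n * exp (- real n * s) \<le> \<bar>t\<bar> ^ n / fact n * 1"
      using elim by (intro mult_left_mono) auto
    then show ?case unfolding ng by simp
  qed
  have meas: "g n \<in> borel_measurable P" for n unfolding g_def by simp
  have int: "integrable P (g n)" for n
    by (rule integrable_const_bound[OF le meas])
  have summ: "summable (\<lambda>n. \<bar>t\<bar> ^ n / fact n)"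
    using summable_exp[of "\<bar>t\<bar>"] by (simp add: divide_inverse mult.commute)
  have AEs: "AE s in P. summable (\<lambda>n. norm (g n s))"
  proof -
    have "AE s in P. \<forall>n. norm (g n s) \<le> \<bar>t\<bar> ^ n / fact n"
      using le by (simp add: AE_all_countable)
    then show ?thesis
    proof eventually_elim
      case (elim s)
      then show ?case by (intro summable_comparison_test'[OF summ]) auto
    qed
  qed
  have Ile: "(\<integral>s. norm (g n s) \<partial>P) \<le> \<bar>t\<bar> ^ n / fact n" for n
    by (rule integral_le_const[OF integrable_norm[OF int] le])
  have sumI: "summable (\<lambda>n. \<integral>s. norm (g n s) \<partial>P)"
    by (rule summable_comparison_test'[OF summ]) (use Ile in \<open>auto simp: abs_of_nonneg\<close>)
  have "char (distr P borel (\<lambda>s. exp (- s))) t = (\<integral>s. iexp (t * exp (- s)) \<partial>P)"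
    unfolding char_def by (subst integral_distr) auto
  also have "\<dots> = (\<integral>s. (\<Sum>n. g n s) \<partial>P)"
  proof (rule Bochner_Integration.integral_cong[OF refl])
    fix s
    have "(\<lambda>n. (\<i> * of_real (t * exp (- s))) ^ n /\<^sub>R fact n) sums iexp (t * exp (- s))"
      by (rule exp_converges)
    moreover have "(\<i> * of_real (t * exp (- s))) ^ n /\<^sub>R fact n = g n s" for n
    proof -
      have "exp (- real n * s) = exp (- s) ^ n"
        by (simp add: exp_of_nat_mult[symmetric])
      then show ?thesis
        by (simp add: g_def scaleR_conv_of_real power_mult_distrib divide_inverse mult_ac)
    qed
    ultimately show "iexp (t * exp (- s)) = (\<Sum>n. g n s)"
      by (simp add: sums_iff)
  qed
  also have "\<dots> = (\<Sum>n. \<integral>s. g n s \<partial>P)"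
    by (rule integral_suminf[OF int AEs sumI])
  also have "\<dots> = (\<Sum>n. (\<i> * of_real t) ^ n / fact n * of_real (if n = 0 then 1 else f (real n)))"
  proof (rule suminf_cong)
    fix n
    have "(\<integral>s. exp (- real n * s) \<partial>P) = (if n = 0 then 1 else f (real n))"
      using f[of "real n"] prob_space by simp
    then show "(\<integral>s. g n s \<partial>P) = (\<i> * of_real t) ^ n / fact n * of_real (if n = 0 then 1 else f (real n))"
      unfolding g_def by (simp only: integral_mult_right_zero integral_complex_of_real)
  qed
  finally show ?thesis .
qed

text \<open>
  By Levy's uniqueness theorem the images under \<open>s \<mapsto> exp (- s)\<close> agree, and this map is inverted by
  \<open>x \<mapsto> - ln x\<close>.
\<close>

lemma represents_laplace_unique:
  assumes P: "represents_laplace P f" and Q: "represents_laplace Q f"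
  shows "P = Q"
proof -
  let ?N = "\<lambda>P. distr P borel (\<lambda>s::real. exp (- s))"
  have dist: "real_distribution (?N P)" and recover: "distr (?N P) borel (\<lambda>x. - ln x) = P"
    if "represents_laplace P f" for P
  proof -
    interpret real_distribution P using that by (simp add: represents_laplace_def)
    show "real_distribution (?N P)" by (rule real_distribution_distr) simp
    have "distr (?N P) borel (\<lambda>x. - ln x) = distr P borel (\<lambda>s. s)"
      by (subst distr_distr) (auto simp: o_def)
    also have "\<dots> = P" by (rule distr_id2) simp
    finally show "distr (?N P) borel (\<lambda>x. - ln x) = P" .
  qed
  have "char (?N P) = char (?N Q)"
    by (rule ext) (simp only: char_exp_uminus_eq_laplace_series[OF P] char_exp_uminus_eq_laplace_series[OF Q])
  then have "?N P = ?N Q" by (intro Levy_uniqueness dist P Q)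
  then have "distr (?N P) borel (\<lambda>x. - ln x) = distr (?N Q) borel (\<lambda>x. - ln x)" by (simp only:)
  then show "P = Q" unfolding recover[OF P] recover[OF Q] .
qed

lemma laplace_measure_eq:
  "represents_laplace P f \<Longrightarrow> laplace_measure f = P"
  unfolding laplace_measure_def by (rule the_equality) (assumption, erule represents_laplace_unique)

section \<open>Measures with Lebesgue densities, and inversion on the line\<close>

text \<open>
  A measure given by a set function need not have that function as its values unless the function is
  known to be a measure; here this follows because it agrees with a density on all Borel sets.
\<close>

lemma measure_of_eq_density:
  fixes S :: "real \<Rightarrow> ennreal"
  assumes [measurable]: "S \<in> borel_measurable borel"
    and "\<And>B. B \<in> sets borel \<Longrightarrow> \<mu> B = (\<integral>\<^sup>+ x. S x * indicator B x \<partial>lborel)"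
  shows "measure_of UNIV (sets borel) \<mu> = density lborel S"
proof -
  let ?N = "density lborel S"
  have eq: "\<mu> B = emeasure ?N B" if "B \<in> sets borel" for B
    unfolding assms(2)[OF that] by (rule emeasure_density[symmetric]) (use that in simp_all)
  have "measure_of UNIV (sets borel) \<mu> = measure_of UNIV (sets borel) (emeasure ?N)"
  proof (rule measure_of_eq)
    have "sigma_sets UNIV (sets borel) = sets (borel :: real measure)"
      using sets.sigma_sets_eq[of "borel :: real measure"] by simp
    then show "\<And>B. B \<in> sigma_sets UNIV (sets borel) \<Longrightarrow> \<mu> B = emeasure ?N B"
      by (intro eq) (simp only:)
  qed simp
  also have "\<dots> = ?N" using measure_of_of_measure[of ?N] by simp
  finally show ?thesis .
qed

lemma measure_of_punctured_eq_density:
  assumes [measurable]: "S \<in> borel_measurable borel"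
    and "\<And>B. B \<in> sets borel \<Longrightarrow> 0 \<notin> B \<Longrightarrow> \<mu> B = (\<integral>\<^sup>+ x. S x * indicator B x \<partial>lborel)"
  shows "measure_of (- {0}) (sets (restrict_space borel (- {0}))) \<mu>
    = density (restrict_space lborel (- {0 :: real})) S"
proof -
  let ?R = "restrict_space lborel (- {0 :: real})"
  let ?N = "density ?R S"
  have sp: "space ?N = - {0}" by (simp add: space_restrict_space)
  have se: "sets ?N = sets (restrict_space borel (- {0}))"
    by (simp add: sets_restrict_space)
  have meas: "S \<in> borel_measurable ?R"
    by (rule measurable_restrict_space1) simp
  have eq: "\<mu> B = emeasure ?N B" if "B \<in> sets (restrict_space borel (- {0}))" for B
  proof -
    from that have B: "B \<in> sets borel" "0 \<notin> B"
      by (auto simp: sets_restrict_space_iff)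
    have "emeasure ?N B = (\<integral>\<^sup>+ x. S x * indicator B x \<partial>?R)"
      using that by (intro emeasure_density meas) (simp add: sets_restrict_space)
    also have "\<dots> = (\<integral>\<^sup>+ x. S x * indicator B x * indicator (- {0}) x \<partial>lborel)"
      by (rule nn_integral_restrict_space) simp
    also have "\<dots> = (\<integral>\<^sup>+ x. S x * indicator B x \<partial>lborel)"
      using B by (intro nn_integral_cong) (auto simp: indicator_def)
    finally show ?thesis using assms(2)[OF B] by simp
  qed
  have sig: "sigma_sets (- {0}) (sets (restrict_space borel (- {0::real}))) = sets (restrict_space borel (- {0}))"
    using sets.sigma_sets_eq[of "restrict_space borel (- {0::real})"] by (simp add: space_restrict_space)
  have "measure_of (- {0}) (sets (restrict_space borel (- {0}))) \<mu>
    = measure_of (- {0}) (sets (restrict_space borel (- {0}))) (emeasure ?N)"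
  proof (rule measure_of_eq)
    show "sets (restrict_space borel (- {0::real})) \<subseteq> Pow (- {0})"
      using sets.space_closed[of "restrict_space borel (- {0::real})"] by (simp add: space_restrict_space)
  qed (simp only: sig eq)
  also have "\<dots> = ?N" using measure_of_of_measure[of ?N] unfolding sp se .
  finally show ?thesis .
qed

lemma nn_integral_lborel_reflect:
  fixes f :: "real \<Rightarrow> ennreal"
  assumes "f \<in> borel_measurable borel"
  shows "(\<integral>\<^sup>+ x. f x \<partial>lborel) = (\<integral>\<^sup>+ x. f (- x) \<partial>lborel)"
  using nn_integral_real_affine[OF assms, of "-1" 0] by simp

text \<open>
  The map \<open>x \<mapsto> - 1/x\<close> is chosen instead of \<open>1/x\<close> because it is increasing, as substitution on
  compact intervals requires.  No integrability is assumed, since a Rosinski measure may be infinite near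
  the origin; the half-lines are exhausted by the intervals \<open>[1/(n+2), n+2]\<close>, where the offset 2 keeps
  the left end point strictly below the right one.
\<close>

lemma nn_integral_inversion_half:
  fixes f :: "real \<Rightarrow> ennreal"
  assumes [measurable]: "f \<in> borel_measurable borel"
  shows "(\<integral>\<^sup>+ x. f x * indicator {..<0} x \<partial>lborel)
    = (\<integral>\<^sup>+ x. f (- 1 / x) * ennreal (1 / x\<^sup>2) * indicator {0<..} x \<partial>lborel)"
proof -
  define I where "I n = {1 / (real n + 2) .. real n + 2}" for n
  define J where "J n = {- (real n + 2) .. - 1 / (real n + 2)}" for n
  let ?g = "\<lambda>x. f (- 1 / x) * ennreal (1 / x\<^sup>2)"
  have arch: "\<exists>n. 1 / (real n + 2) \<le> x \<and> x \<le> real n + 2" if "0 < x" for x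
  proof -
    obtain n where n: "max x (1 / x) \<le> real n" using real_arch_simple by blast
    then have "1 / x \<le> real n + 2" "x \<le> real n + 2" by auto
    then show ?thesis using that by (intro exI[of _ n]) (auto simp: field_simps)
  qed
  have UI: "(\<Union>n. I n) = {0<..}"
  proof (intro equalityI subsetI)
    fix x assume "x \<in> (\<Union>n. I n)"
    then obtain n where "1 / (real n + 2) \<le> x" by (auto simp: I_def)
    moreover have "0 < 1 / (real n + 2)" by simp
    ultimately have "0 < x" by linarith
    then show "x \<in> {0<..}" by simp
  qed (use arch in \<open>auto simp: I_def\<close>)
  have UJ: "(\<Union>n. J n) = {..<0}"
  proof (intro equalityI subsetI)
    fix x assume "x \<in> (\<Union>n. J n)"
    then obtain n where "x \<le> - 1 / (real n + 2)" by (auto simp: J_def)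
    moreover have "- 1 / (real n + 2) < 0" by simp
    ultimately have "x < 0" by linarith
    then show "x \<in> {..<0}" by simp
  next
    fix x :: real assume "x \<in> {..<0}"
    then obtain n where "1 / (real n + 2) \<le> - x" "- x \<le> real n + 2" using arch[of "- x"] by auto
    then have "x \<in> J n" by (simp add: J_def)
    then show "x \<in> (\<Union>n. J n)" by blast
  qed
  have dec: "1 / (real n + 2) \<le> 1 / (real m + 2)" if "m \<le> n" for m n
    using that by (intro divide_left_mono) auto
  have incI: "incseq I"
    unfolding incseq_def I_def using dec by (auto intro: order_trans)
  have incJ: "incseq J"
    unfolding incseq_def J_def
  proof (intro allI impI)
    fix m n :: nat assume "m \<le> n"
    with dec[OF this] show "{- (real m + 2)..- 1 / (real m + 2)} \<subseteq> {- (real n + 2)..- 1 / (real n + 2)}"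
      by simp
  qed
  have step: "emeasure (density lborel f) (J n) = emeasure (density lborel ?g) (I n)" for n
  proof -
    have lt: "1 / (real n + 2) < real n + 2"
    proof -
      have "1 / (real n + 2) < 1" by simp
      then show ?thesis by linarith
    qed
    have pos: "0 < x" if "x \<in> {1 / (real n + 2) .. real n + 2}" for x
    proof -
      have "0 < 1 / (real n + 2)" by simp
      also have "1 / (real n + 2) \<le> x" using that by simp
      finally show ?thesis .
    qed
    have "(\<integral>\<^sup>+x. f x * indicator {- 1 / (1 / (real n + 2)) .. - 1 / (real n + 2)} x \<partial>lborel) =
        (\<integral>\<^sup>+x. f (- 1 / x) * ennreal (1 / x\<^sup>2) * indicator {1 / (real n + 2) .. real n + 2} x \<partial>lborel)"
    proof (rule nn_integral_substitution_aux[OF assms])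
      show "((\<lambda>x. - 1 / x) has_real_derivative 1 / x\<^sup>2) (at x)" if "x \<in> {1 / (real n + 2) .. real n + 2}" for x
        using pos[OF that] by (auto intro!: derivative_eq_intros simp: power2_eq_square)
      show "continuous_on {1 / (real n + 2)..real n + 2} (\<lambda>x. 1 / x\<^sup>2)"
        by (intro continuous_intros) (auto dest: pos)
    qed (use lt in auto)
    then show ?thesis
      by (simp add: emeasure_density I_def J_def)
  qed
  have "(\<integral>\<^sup>+ x. f x * indicator {..<0} x \<partial>lborel) = emeasure (density lborel f) (\<Union>n. J n)"
    unfolding UJ by (simp add: emeasure_density)
  also have "\<dots> = (SUP n. emeasure (density lborel f) (J n))"
    by (rule SUP_emeasure_incseq[OF _ incJ, symmetric]) (auto simp: J_def)
  also have "\<dots> = (SUP n. emeasure (density lborel ?g) (I n))" by (simp only: step)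
  also have "\<dots> = emeasure (density lborel ?g) (\<Union>n. I n)"
    by (rule SUP_emeasure_incseq[OF _ incI]) (auto simp: I_def)
  also have "\<dots> = (\<integral>\<^sup>+ x. ?g x * indicator {0<..} x \<partial>lborel)"
    unfolding UI by (simp add: emeasure_density)
  finally show ?thesis .
qed

text \<open>
  Both half-lines at once: reflection turns the previous substitution into \<open>x \<mapsto> 1/x\<close>.
\<close>

lemma nn_integral_inversion:
  fixes h :: "real \<Rightarrow> ennreal"
  assumes [measurable]: "h \<in> borel_measurable borel"
  shows "(\<integral>\<^sup>+ x. h x * indicator (- {0}) x \<partial>lborel)
    = (\<integral>\<^sup>+ x. h (1 / x) * ennreal (1 / x\<^sup>2) * indicator (- {0}) x \<partial>lborel)"
proof -
  let ?g = "\<lambda>x. h (1 / x) * ennreal (1 / x\<^sup>2)"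
  have split: "(\<integral>\<^sup>+ x. k x * indicator (- {0}) x \<partial>lborel)
    = (\<integral>\<^sup>+ x. k x * indicator {..<0} x \<partial>lborel) + (\<integral>\<^sup>+ x. k x * indicator {0<..} x \<partial>lborel)"
    if [measurable]: "k \<in> borel_measurable borel" for k :: "real \<Rightarrow> ennreal"
  proof -
    have "(\<integral>\<^sup>+ x. k x * indicator (- {0}) x \<partial>lborel) =
      (\<integral>\<^sup>+ x. k x * indicator {..<0} x + k x * indicator {0<..} x \<partial>lborel)"
      by (intro nn_integral_cong) (auto simp: indicator_def)
    then show ?thesis by (simp add: nn_integral_add)
  qed
  have neg: "(\<integral>\<^sup>+ x. h x * indicator {..<0} x \<partial>lborel) = (\<integral>\<^sup>+ x. ?g x * indicator {..<0} x \<partial>lborel)"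
    unfolding nn_integral_inversion_half[OF assms]
    by (subst nn_integral_lborel_reflect) (auto intro!: nn_integral_cong simp: indicator_def)
  have pos: "(\<integral>\<^sup>+ x. h x * indicator {0<..} x \<partial>lborel) = (\<integral>\<^sup>+ x. ?g x * indicator {0<..} x \<partial>lborel)"
  proof -
    have "(\<integral>\<^sup>+ x. h x * indicator {0<..} x \<partial>lborel) = (\<integral>\<^sup>+ x. h (- x) * indicator {..<0} x \<partial>lborel)"
      by (subst nn_integral_lborel_reflect) (auto intro!: nn_integral_cong simp: indicator_def)
    also have "\<dots> = (\<integral>\<^sup>+ x. ?g x * indicator {0<..} x \<partial>lborel)"
      by (subst nn_integral_inversion_half) auto
    finally show ?thesis .
  qed
  show ?thesis by (simp only: split[of h] split[of ?g] neg pos assms, subst split) auto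
qed

lemma nn_integral_two_sided:
  fixes hp hm :: "real \<Rightarrow> ennreal"
  assumes [measurable]: "hp \<in> borel_measurable borel" "hm \<in> borel_measurable borel" "B \<in> sets borel"
  shows "ennreal \<delta>p * (\<integral>\<^sup>+ r. indicator B (r * 1) * hp r \<partial>lborel)
       + ennreal \<delta>m * (\<integral>\<^sup>+ r. indicator B (r * - 1) * hm r \<partial>lborel)
       = (\<integral>\<^sup>+ x. (ennreal \<delta>p * hp x + ennreal \<delta>m * hm (- x)) * indicator B x \<partial>lborel)"
proof -
  have "(\<integral>\<^sup>+ r. indicator B (r * - 1) * hm r \<partial>lborel) = (\<integral>\<^sup>+ x. indicator B x * hm (- x) \<partial>lborel)"
    by (subst nn_integral_lborel_reflect) auto
  moreover have "(\<integral>\<^sup>+ x. (ennreal \<delta>p * hp x + ennreal \<delta>m * hm (- x)) * indicator B x \<partial>lborel)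
    = (\<integral>\<^sup>+ x. ennreal \<delta>p * (indicator B x * hp x) + ennreal \<delta>m * (indicator B x * hm (- x)) \<partial>lborel)"
    by (intro nn_integral_cong) (simp add: distrib_left distrib_right mult_ac)
  ultimately show ?thesis by (simp add: nn_integral_add nn_integral_cmult)
qed

section \<open>Polar form, spectral measure and Rosinski measure\<close>

lemma nn_integral_GTGS_sigma:
  "(\<integral>\<^sup>+ u. f u \<partial>GTGS_sigma (\<delta>p, \<delta>m)) = ennreal \<delta>p * f 1 + ennreal \<delta>m * f (- 1)"
  by (simp add: nn_integral_point_measure_finite)

lemma mittag_leffler_measurable [measurable]: "mittag_leffler a \<in> borel_measurable borel"
  unfolding mittag_leffler_def[abs_def] by measurable

text \<open>
  Each of the two masses of the spherical measure contributes the Levy density on one half-line.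
\<close>

lemma polar_measure_eq_levy_density:
  assumes "0 \<le> \<delta>p" "0 \<le> \<delta>m"
  shows "polar_measure \<gamma> (GTGS_sigma (\<delta>p, \<delta>m)) (GTGS_q (\<alpha>p, \<alpha>m) (lp, lm) (\<theta>p, \<theta>m))
    = density lborel (\<lambda>x. ennreal (GTGS_levy_density \<gamma> (\<alpha>p, \<alpha>m) (lp, lm) (\<theta>p, \<theta>m) (\<delta>p, \<delta>m) x))"
  unfolding polar_measure_def
proof (rule measure_of_eq_density)
  let ?q = "GTGS_q (\<alpha>p, \<alpha>m) (lp, lm) (\<theta>p, \<theta>m)"
  let ?L = "GTGS_levy_density \<gamma> (\<alpha>p, \<alpha>m) (lp, lm) (\<theta>p, \<theta>m) (\<delta>p, \<delta>m)"
  let ?h = "\<lambda>u r. indicator {0<..} r * ennreal (?q r u * r powr (- 1 - \<gamma>))"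
  have hm: "?h u \<in> borel_measurable borel" for u by (cases "u = 1") simp_all
  show "(\<lambda>x. ennreal (?L x)) \<in> borel_measurable borel" by simp
  fix B :: "real set" assume B: "B \<in> sets borel"
  have "x powr (- 1 - \<gamma>) = 1 / x powr (1 + \<gamma>)" for x :: real
    using powr_minus_divide[of x "1 + \<gamma>"] by simp
  then have pt: "ennreal (?L x) = ennreal \<delta>p * ?h 1 x + ennreal \<delta>m * ?h (- 1) (- x)" for x
    using assms by (cases x "0 :: real" rule: linorder_cases) (simp_all add: ennreal_mult'[symmetric] mult_ac)
  have "(\<integral>\<^sup>+ u. (\<integral>\<^sup>+ r. indicator B (r * u) * indicator {0<..} r *
            ennreal (?q r u * r powr (- 1 - \<gamma>)) \<partial>lborel) \<partial>GTGS_sigma (\<delta>p, \<delta>m))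
     = ennreal \<delta>p * (\<integral>\<^sup>+ r. indicator B (r * 1) * ?h 1 r \<partial>lborel)
       + ennreal \<delta>m * (\<integral>\<^sup>+ r. indicator B (r * - 1) * ?h (- 1) r \<partial>lborel)"
    unfolding nn_integral_GTGS_sigma by (simp only: mult.assoc)
  also have "\<dots> = (\<integral>\<^sup>+ x. ennreal (?L x) * indicator B x \<partial>lborel)"
    unfolding nn_integral_two_sided[OF hm hm B] pt ..
  finally show "(\<integral>\<^sup>+ u. (\<integral>\<^sup>+ r. indicator B (r * u) * indicator {0<..} r *
            ennreal (?q r u * r powr (- 1 - \<gamma>)) \<partial>lborel) \<partial>GTGS_sigma (\<delta>p, \<delta>m))
     = (\<integral>\<^sup>+ x. ennreal (?L x) * indicator B x \<partial>lborel)" .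
qed

lemma spectral_measure_eq_density:
  assumes [measurable]: "gp \<in> borel_measurable borel" "gm \<in> borel_measurable borel"
    and nonneg: "\<And>x. 0 \<le> gp x" "\<And>x. 0 \<le> gm x" "0 \<le> \<delta>p" "0 \<le> \<delta>m"
    and P: "represents_laplace (density lborel (\<lambda>x. ennreal (gp x))) (\<lambda>r. q r 1)"
    and M: "represents_laplace (density lborel (\<lambda>x. ennreal (gm x))) (\<lambda>r. q r (- 1))"
  shows "spectral_measure (GTGS_sigma (\<delta>p, \<delta>m)) q
    = density (restrict_space lborel (- {0})) (\<lambda>x. ennreal (\<delta>p * gp x + \<delta>m * gm (- x)))"
  unfolding spectral_measure_def
proof (rule measure_of_punctured_eq_density)
  show "(\<lambda>x. ennreal (\<delta>p * gp x + \<delta>m * gm (- x))) \<in> borel_measurable borel" by measurable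
  fix B :: "real set" assume [measurable]: "B \<in> sets borel"
  have dens: "(\<integral>\<^sup>+ r. indicator B (r * u) \<partial>density lborel (\<lambda>x. ennreal (g x)))
      = (\<integral>\<^sup>+ r. indicator B (r * u) * ennreal (g r) \<partial>lborel)"
    if [measurable]: "g \<in> borel_measurable borel" for g u
    by (subst nn_integral_density) (auto simp: mult.commute)
  have "(\<integral>\<^sup>+ u. (\<integral>\<^sup>+ r. indicator B (r * u) \<partial>laplace_measure (\<lambda>r. q r u)) \<partial>GTGS_sigma (\<delta>p, \<delta>m))
     = ennreal \<delta>p * (\<integral>\<^sup>+ r. indicator B (r * 1) * ennreal (gp r) \<partial>lborel)
       + ennreal \<delta>m * (\<integral>\<^sup>+ r. indicator B (r * - 1) * ennreal (gm r) \<partial>lborel)"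
    unfolding nn_integral_GTGS_sigma laplace_measure_eq[OF P] laplace_measure_eq[OF M]
    by (simp only: dens assms(1,2))
  also have "\<dots> = (\<integral>\<^sup>+ x. (ennreal \<delta>p * ennreal (gp x) + ennreal \<delta>m * ennreal (gm (- x))) * indicator B x \<partial>lborel)"
    by (rule nn_integral_two_sided) measurable
  also have "\<dots> = (\<integral>\<^sup>+ x. ennreal (\<delta>p * gp x + \<delta>m * gm (- x)) * indicator B x \<partial>lborel)"
    by (simp add: nonneg ennreal_mult ennreal_plus)
  finally show "(\<integral>\<^sup>+ u. (\<integral>\<^sup>+ r. indicator B (r * u) \<partial>laplace_measure (\<lambda>r. q r u)) \<partial>GTGS_sigma (\<delta>p, \<delta>m))
     = (\<integral>\<^sup>+ x. ennreal (\<delta>p * gp x + \<delta>m * gm (- x)) * indicator B x \<partial>lborel)" .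
qed

lemma rosinski_measure_eq_density:
  assumes [measurable]: "S \<in> borel_measurable borel" and nonneg: "\<And>x. 0 \<le> S x"
    and [measurable]: "R \<in> borel_measurable borel"
    and R: "\<And>x. x \<noteq> 0 \<Longrightarrow> R x = \<bar>x\<bar> powr (- \<gamma>) / x\<^sup>2 * S (1 / x)"
  shows "rosinski_measure \<gamma> (density (restrict_space lborel (- {0})) (\<lambda>x. ennreal (S x)))
    = density (restrict_space lborel (- {0})) (\<lambda>x. ennreal (R x))"
  unfolding rosinski_measure_def
proof (rule measure_of_punctured_eq_density)
  show "(\<lambda>x. ennreal (R x)) \<in> borel_measurable borel" by measurable
  fix B :: "real set" assume [measurable]: "B \<in> sets borel" and B0: "0 \<notin> B"
  let ?\<Omega> = "restrict_space lborel (- {0::real})"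
  let ?k = "\<lambda>x. indicator B (x / \<bar>x\<bar>\<^sup>2) * ennreal (\<bar>x\<bar> powr \<gamma>)"
  let ?h = "\<lambda>x. ennreal (S x) * ?k x"
  have km: "?k \<in> borel_measurable borel" by measurable
  have hm: "?h \<in> borel_measurable borel" by measurable
  have "(\<integral>\<^sup>+ x. ?k x \<partial>density ?\<Omega> (\<lambda>x. ennreal (S x))) = (\<integral>\<^sup>+ x. ?h x \<partial>?\<Omega>)"
    using km by (intro nn_integral_density measurable_restrict_space1) simp_all
  also have "\<dots> = (\<integral>\<^sup>+ x. ?h x * indicator (- {0}) x \<partial>lborel)"
    by (rule nn_integral_restrict_space) simp
  also have "\<dots> = (\<integral>\<^sup>+ x. ?h (1 / x) * ennreal (1 / x\<^sup>2) * indicator (- {0}) x \<partial>lborel)"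
    by (rule nn_integral_inversion[OF hm])
  also have "\<dots> = (\<integral>\<^sup>+ x. ennreal (R x) * indicator B x \<partial>lborel)"
  proof (rule nn_integral_cong)
    fix x :: real
    show "?h (1 / x) * ennreal (1 / x\<^sup>2) * indicator (- {0}) x = ennreal (R x) * indicator B x"
    proof (cases "x = 0")
      case False
      then have inv: "1 / x / \<bar>1 / x\<bar>\<^sup>2 = x" by (simp add: power2_eq_square)
      have pw: "\<bar>1 / x\<bar> powr \<gamma> = \<bar>x\<bar> powr (- \<gamma>)"
        using False by (simp add: powr_minus_divide powr_divide)
      have "ennreal (R x) = ennreal (S (1 / x)) * ennreal (\<bar>x\<bar> powr (- \<gamma>)) * ennreal (1 / x\<^sup>2)"
        unfolding R[OF False] by (simp add: ennreal_mult[symmetric] nonneg mult.commute)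
      then show ?thesis unfolding inv pw using False by (simp add: mult_ac)
    qed (use B0 in simp)
  qed
  finally show "(\<integral>\<^sup>+ x. ?k x \<partial>density ?\<Omega> (\<lambda>x. ennreal (S x))) = (\<integral>\<^sup>+ x. ennreal (R x) * indicator B x \<partial>lborel)" .
qed

text \<open>
  With \<open>v = 1 - \<theta> x\<close> the argument of \<open>ml_density\<close> is \<open>1/x - \<theta> = v/x\<close>; multiplying numerator
  and denominator by \<open>x powr (2a)\<close> clears the inner fractions.  The constraint \<open>1/x > \<theta>\<close> becomes
  \<open>x < 1/\<theta>\<close>, read as \<open>x < \<infinity>\<close> for \<open>\<theta> = 0\<close>.
\<close>

lemma tempered_density_inversion:
  assumes x: "0 < x" and \<theta>: "0 \<le> \<theta>"
  shows "x powr (- \<gamma>) / x\<^sup>2 * tempered_density a l \<theta> (1 / x) =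
     (x powr (- \<gamma> + a - 1) / pi) *
               ((1 - \<theta> * x) powr (a - 1) * sin (a * pi) /
                 (inverse l * (1 - \<theta> * x) powr (2 * a)
                  + 2 * (x * (1 - \<theta> * x)) powr a * cos (a * pi)
                  + l * x powr (2 * a))) *
               indicator {y. 0 < y \<and> ereal y < 1 / ereal \<theta>} x"
proof -
  have "ereal x < 1 / ereal \<theta> \<longleftrightarrow> \<theta> < 1 / x"
  proof (cases "\<theta> = 0")
    case True
    then show ?thesis using x by (simp add: divide_ereal_def)
  next
    case False
    then have "1 / ereal \<theta> = ereal (1 / \<theta>)" by (simp add: one_ereal_def)
    then show ?thesis using x \<theta> False by (simp add: field_simps)
  qed
  then have ind: "indicator {y. 0 < y \<and> ereal y < 1 / ereal \<theta>} x = (indicator {\<theta><..} (1 / x) :: real)"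
    using x by (simp add: indicator_def)
  show ?thesis
  proof (cases "\<theta> < 1 / x")
    case True
    define v where "v = 1 - \<theta> * x"
    have v: "v > 0" using True x by (simp add: v_def field_simps)
    have s: "1 / x - \<theta> = v / x" using x by (simp add: v_def field_simps)
    define X V W G where "X = x powr a" and "V = v powr a" and "W = v powr (a - 1)" and "G = x powr (- \<gamma>)"
    define c sn D where "c = cos (a * pi)" and "sn = sin (a * pi)"
      and "D = inverse l * V\<^sup>2 + 2 * (X * V) * c + l * X\<^sup>2"
    have X: "X > 0" using x by (simp add: X_def)
    have p1: "x powr (a - 1) = X / x" using x by (simp add: X_def powr_diff)
    have "- \<gamma> + a - 1 = - \<gamma> + (a - 1)" by simp
    then have p2: "x powr (- \<gamma> + a - 1) = G * X / x"
      by (simp only: G_def powr_add p1 times_divide_eq_right)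
    have p3: "y powr (2 * a) = (y powr a)\<^sup>2" for y :: real
      by (simp only: mult_2 powr_add power2_eq_square)
    have p4: "(x * v) powr a = X * V" using x v by (simp add: X_def V_def powr_mult)
    have p5: "(v / x) powr a = V / X" using x v by (simp add: X_def V_def powr_divide)
    have p6: "(v / x) powr (a - 1) = W * x / X"
      using x v by (simp add: W_def powr_divide p1)
    have D: "inverse l * (V / X)\<^sup>2 + 2 * (V / X) * c + l = D / X\<^sup>2"
      using X by (simp add: D_def power_divide add_divide_distrib power2_eq_square)
    have "G / x\<^sup>2 * (W * x / X / pi * (sn / (D / X\<^sup>2))) = G * X / x / pi * (W * sn / D)"
      using x X by (cases "D = 0") (simp_all add: power2_eq_square field_simps)
    then show ?thesis
      unfolding ind tempered_density_def ml_density_def s v_def[symmetric] p2 p3 p4 p5 p6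
        c_def[symmetric] sn_def[symmetric] G_def[symmetric] W_def[symmetric]
        V_def[symmetric] X_def[symmetric] D
      using True by (simp add: D_def)
  next
    case False
    then show ?thesis by (simp add: ind tempered_density_def)
  qed
qed

text \<open>
  The factor \<open>x powr (- \<gamma>)\<close> is the weight \<open>\<bar>y\<bar> powr \<gamma>\<close> at \<open>y = 1/x\<close>, and \<open>1 / x\<^sup>2\<close> is
  the Jacobian of the inversion.
\<close>

definition inverted_density :: "real \<Rightarrow> (real \<Rightarrow> real) \<Rightarrow> real \<Rightarrow> real" where
  "inverted_density \<gamma> g x = (if 0 < x then x powr (- \<gamma>) / x\<^sup>2 * g (1 / x) else 0)"

lemma inverted_density_measurable [measurable]:
  assumes [measurable]: "g \<in> borel_measurable borel"
  shows "inverted_density \<gamma> g \<in> borel_measurable borel"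
  unfolding inverted_density_def[abs_def] by measurable

lemma has_lebesgue_density_punctured:
  assumes "f \<in> borel_measurable borel" "\<And>x. 0 \<le> f x"
    and "N = density (restrict_space lborel (- {0})) (\<lambda>x. ennreal (f x))"
  shows "has_lebesgue_density N f"
  unfolding has_lebesgue_density_def using assms by (simp add: space_restrict_space)

theorem proposition3:
  fixes \<gamma> \<alpha>p \<alpha>m lp lm \<theta>p \<theta>m \<delta>p \<delta>m \<mu> :: real and M :: "real measure"
  assumes "0 < \<gamma>" "\<gamma> < 2"
    and "0 < \<alpha>p" "\<alpha>p < 1" "0 < \<alpha>m" "\<alpha>m < 1"
    and "0 < lp" "0 < lm"
    and "0 \<le> \<theta>p" "0 \<le> \<theta>m"
    and "0 \<le> \<delta>p" "0 \<le> \<delta>m" "(\<delta>p, \<delta>m) \<noteq> (0, 0)"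
    and "GTGS_law \<gamma> (\<alpha>p, \<alpha>m) (lp, lm) (\<theta>p, \<theta>m) (\<delta>p, \<delta>m) \<mu> M"
  defines "q \<equiv> GTGS_q (\<alpha>p, \<alpha>m) (lp, lm) (\<theta>p, \<theta>m)"
    and "\<sigma> \<equiv> GTGS_sigma (\<delta>p, \<delta>m)"
  shows "has_levy_triplet M \<mu> 0 (polar_measure \<gamma> \<sigma> q)
    \<and> (\<forall>u\<in>{1, -1}. \<exists>!P. represents_laplace P (\<lambda>r. q r u))
    \<and> has_lebesgue_density (spectral_measure \<sigma> q)
        (\<lambda>x. \<delta>p * ((x - \<theta>p) powr (\<alpha>p - 1) / pi) *
               (sin (\<alpha>p * pi) /
                 (inverse lp * (x - \<theta>p) powr (2 * \<alpha>p)
                  + 2 * (x - \<theta>p) powr \<alpha>p * cos (\<alpha>p * pi) + lp)) *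
               indicator {\<theta>p<..} x
           + \<delta>m * ((\<bar>x\<bar> - \<theta>m) powr (\<alpha>m - 1) / pi) *
               (sin (\<alpha>m * pi) /
                 (inverse lm * (\<bar>x\<bar> - \<theta>m) powr (2 * \<alpha>m)
                  + 2 * (\<bar>x\<bar> - \<theta>m) powr \<alpha>m * cos (\<alpha>m * pi) + lm)) *
               indicator {..<- \<theta>m} x)
    \<and> has_lebesgue_density (rosinski_measure \<gamma> (spectral_measure \<sigma> q))
        (\<lambda>x. \<delta>p * (x powr (- \<gamma> + \<alpha>p - 1) / pi) *
               ((1 - \<theta>p * x) powr (\<alpha>p - 1) * sin (\<alpha>p * pi) /
                 (inverse lp * (1 - \<theta>p * x) powr (2 * \<alpha>p)
                  + 2 * (x * (1 - \<theta>p * x)) powr \<alpha>p * cos (\<alpha>p * pi)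
                  + lp * x powr (2 * \<alpha>p))) *
               indicator {y. 0 < y \<and> ereal y < 1 / ereal \<theta>p} x
           + \<delta>m * (\<bar>x\<bar> powr (- \<gamma> + \<alpha>m - 1) / pi) *
               ((1 - \<theta>m * \<bar>x\<bar>) powr (\<alpha>m - 1) * sin (\<alpha>m * pi) /
                 (inverse lm * (1 - \<theta>m * \<bar>x\<bar>) powr (2 * \<alpha>m)
                  + 2 * (\<bar>x\<bar> * (1 - \<theta>m * \<bar>x\<bar>)) powr \<alpha>m * cos (\<alpha>m * pi)
                  + lm * \<bar>x\<bar> powr (2 * \<alpha>m))) *
               indicator {y. - (1 / ereal \<theta>m) < ereal y \<and> y < 0} x)"
proof (intro conjI)
  define gp where "gp = tempered_density \<alpha>p lp \<theta>p"
  define gm where "gm = tempered_density \<alpha>m lm \<theta>m"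
  define S where "S x = \<delta>p * gp x + \<delta>m * gm (- x)" for x
  define R where "R x = \<delta>p * inverted_density \<gamma> gp x + \<delta>m * inverted_density \<gamma> gm (- x)" for x
  have [measurable]: "gp \<in> borel_measurable borel" "gm \<in> borel_measurable borel"
    unfolding gp_def gm_def by measurable
  have [measurable]: "S \<in> borel_measurable borel" "R \<in> borel_measurable borel"
    unfolding S_def[abs_def] R_def[abs_def] by measurable
  have g0: "0 \<le> gp x" "0 \<le> gm x" for x
    unfolding gp_def gm_def using assms by (intro tempered_density_nonneg; simp)+
  have S0: "0 \<le> S x" and R0: "0 \<le> R x" for x
    using g0 assms(11,12) by (simp_all add: S_def R_def inverted_density_def)
  have P: "represents_laplace (density lborel (\<lambda>x. ennreal (gp x))) (\<lambda>r. q r 1)"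
    unfolding gp_def q_def using tempered_density_laplace[of \<alpha>p lp \<theta>p] assms(3,4,7,9) by simp
  have M: "represents_laplace (density lborel (\<lambda>x. ennreal (gm x))) (\<lambda>r. q r (- 1))"
    unfolding gm_def q_def using tempered_density_laplace[of \<alpha>m lm \<theta>m] assms(5,6,8,10) by simp

  show "has_levy_triplet M \<mu> 0 (polar_measure \<gamma> \<sigma> q)"
    using assms(14) unfolding GTGS_law_def \<sigma>_def q_def polar_measure_eq_levy_density[OF assms(11,12)] .
  show "\<forall>u\<in>{1, -1}. \<exists>!P. represents_laplace P (\<lambda>r. q r u)"
    using P M represents_laplace_unique by blast
  have spec: "spectral_measure \<sigma> q = density (restrict_space lborel (- {0})) (\<lambda>x. ennreal (S x))"
    unfolding \<sigma>_def S_def by (rule spectral_measure_eq_density[OF _ _ _ _ _ _ P M]) (use g0 assms in auto)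
  have "has_lebesgue_density (spectral_measure \<sigma> q) S"
    by (rule has_lebesgue_density_punctured[OF _ S0 spec]) measurable
  also have "S = (\<lambda>x. \<delta>p * ((x - \<theta>p) powr (\<alpha>p - 1) / pi) *
               (sin (\<alpha>p * pi) /
                 (inverse lp * (x - \<theta>p) powr (2 * \<alpha>p)
                  + 2 * (x - \<theta>p) powr \<alpha>p * cos (\<alpha>p * pi) + lp)) *
               indicator {\<theta>p<..} x
           + \<delta>m * ((\<bar>x\<bar> - \<theta>m) powr (\<alpha>m - 1) / pi) *
               (sin (\<alpha>m * pi) /
                 (inverse lm * (\<bar>x\<bar> - \<theta>m) powr (2 * \<alpha>m)
                  + 2 * (\<bar>x\<bar> - \<theta>m) powr \<alpha>m * cos (\<alpha>m * pi) + lm)) *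
               indicator {..<- \<theta>m} x)"
  proof
    fix x
    show "S x = (\<lambda>x. \<delta>p * ((x - \<theta>p) powr (\<alpha>p - 1) / pi) *
               (sin (\<alpha>p * pi) /
                 (inverse lp * (x - \<theta>p) powr (2 * \<alpha>p)
                  + 2 * (x - \<theta>p) powr \<alpha>p * cos (\<alpha>p * pi) + lp)) *
               indicator {\<theta>p<..} x
           + \<delta>m * ((\<bar>x\<bar> - \<theta>m) powr (\<alpha>m - 1) / pi) *
               (sin (\<alpha>m * pi) /
                 (inverse lm * (\<bar>x\<bar> - \<theta>m) powr (2 * \<alpha>m)
                  + 2 * (\<bar>x\<bar> - \<theta>m) powr \<alpha>m * cos (\<alpha>m * pi) + lm)) *
               indicator {..<- \<theta>m} x) x"
      unfolding S_def gp_def gm_def tempered_density_def ml_density_def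
      using assms(9,10) by (auto simp: indicator_def)
  qed
  finally show "has_lebesgue_density (spectral_measure \<sigma> q) (\<lambda>x. \<delta>p * ((x - \<theta>p) powr (\<alpha>p - 1) / pi) *
               (sin (\<alpha>p * pi) /
                 (inverse lp * (x - \<theta>p) powr (2 * \<alpha>p)
                  + 2 * (x - \<theta>p) powr \<alpha>p * cos (\<alpha>p * pi) + lp)) *
               indicator {\<theta>p<..} x
           + \<delta>m * ((\<bar>x\<bar> - \<theta>m) powr (\<alpha>m - 1) / pi) *
               (sin (\<alpha>m * pi) /
                 (inverse lm * (\<bar>x\<bar> - \<theta>m) powr (2 * \<alpha>m)
                  + 2 * (\<bar>x\<bar> - \<theta>m) powr \<alpha>m * cos (\<alpha>m * pi) + lm)) *
               indicator {..<- \<theta>m} x)" .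
  \<comment> \<open>Each side density vanishes on the opposite half-line because \<open>\<theta> \<ge> 0\<close>; hence the two summands do not
    interfere under inversion.\<close>
  have gneg: "gp x = 0" "gm x = 0" if "x \<le> 0" for x
    using that assms(9,10) by (auto simp: gp_def gm_def tempered_density_def)
  have "R x = \<bar>x\<bar> powr (- \<gamma>) / x\<^sup>2 * S (1 / x)" if "x \<noteq> 0" for x
    using that by (cases "0 < x") (simp_all add: R_def S_def inverted_density_def gneg)
  then have "rosinski_measure \<gamma> (spectral_measure \<sigma> q)
      = density (restrict_space lborel (- {0})) (\<lambda>x. ennreal (R x))"
    unfolding spec by (intro rosinski_measure_eq_density S0) measurable
  then have "has_lebesgue_density (rosinski_measure \<gamma> (spectral_measure \<sigma> q)) R"
    by (intro has_lebesgue_density_punctured R0) measurable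
  also have "R = (\<lambda>x. \<delta>p * (x powr (- \<gamma> + \<alpha>p - 1) / pi) *
               ((1 - \<theta>p * x) powr (\<alpha>p - 1) * sin (\<alpha>p * pi) /
                 (inverse lp * (1 - \<theta>p * x) powr (2 * \<alpha>p)
                  + 2 * (x * (1 - \<theta>p * x)) powr \<alpha>p * cos (\<alpha>p * pi)
                  + lp * x powr (2 * \<alpha>p))) *
               indicator {y. 0 < y \<and> ereal y < 1 / ereal \<theta>p} x
           + \<delta>m * (\<bar>x\<bar> powr (- \<gamma> + \<alpha>m - 1) / pi) *
               ((1 - \<theta>m * \<bar>x\<bar>) powr (\<alpha>m - 1) * sin (\<alpha>m * pi) /
                 (inverse lm * (1 - \<theta>m * \<bar>x\<bar>) powr (2 * \<alpha>m)
                  + 2 * (\<bar>x\<bar> * (1 - \<theta>m * \<bar>x\<bar>)) powr \<alpha>m * cos (\<alpha>m * pi)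
                  + lm * \<bar>x\<bar> powr (2 * \<alpha>m))) *
               indicator {y. - (1 / ereal \<theta>m) < ereal y \<and> y < 0} x)"
  proof
    fix x
    have ind: "indicator {y. - (1 / ereal \<theta>m) < ereal y \<and> y < 0} x
      = (indicator {y. 0 < y \<and> ereal y < 1 / ereal \<theta>m} (- x) :: real)"
      using ereal_minus_less_minus[of "1 / ereal \<theta>m" "ereal (- x)"] by (simp add: indicator_def conj_commute)
    consider "0 < x" | "x < 0" | "x = 0" by linarith
    then show "R x = (\<lambda>x. \<delta>p * (x powr (- \<gamma> + \<alpha>p - 1) / pi) *
               ((1 - \<theta>p * x) powr (\<alpha>p - 1) * sin (\<alpha>p * pi) /
                 (inverse lp * (1 - \<theta>p * x) powr (2 * \<alpha>p)
                  + 2 * (x * (1 - \<theta>p * x)) powr \<alpha>p * cos (\<alpha>p * pi)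
                  + lp * x powr (2 * \<alpha>p))) *
               indicator {y. 0 < y \<and> ereal y < 1 / ereal \<theta>p} x
           + \<delta>m * (\<bar>x\<bar> powr (- \<gamma> + \<alpha>m - 1) / pi) *
               ((1 - \<theta>m * \<bar>x\<bar>) powr (\<alpha>m - 1) * sin (\<alpha>m * pi) /
                 (inverse lm * (1 - \<theta>m * \<bar>x\<bar>) powr (2 * \<alpha>m)
                  + 2 * (\<bar>x\<bar> * (1 - \<theta>m * \<bar>x\<bar>)) powr \<alpha>m * cos (\<alpha>m * pi)
                  + lm * \<bar>x\<bar> powr (2 * \<alpha>m))) *
               indicator {y. - (1 / ereal \<theta>m) < ereal y \<and> y < 0} x) x"
    proof cases
      case 1
      then show ?thesis
        unfolding R_def inverted_density_def gp_def
        using tempered_density_inversion[OF 1 assms(9), of \<gamma> \<alpha>p lp] by simp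
    next
      case 2
      then have "0 < - x" by simp
      from tempered_density_inversion[OF this assms(10), of \<gamma> \<alpha>m lm] 2 show ?thesis
        unfolding R_def inverted_density_def gm_def ind by simp
    next
      case 3
      then show ?thesis by (simp add: R_def inverted_density_def)
    qed
  qed
  finally show "has_lebesgue_density (rosinski_measure \<gamma> (spectral_measure \<sigma> q)) (\<lambda>x. \<delta>p * (x powr (- \<gamma> + \<alpha>p - 1) / pi) *
               ((1 - \<theta>p * x) powr (\<alpha>p - 1) * sin (\<alpha>p * pi) /
                 (inverse lp * (1 - \<theta>p * x) powr (2 * \<alpha>p)
                  + 2 * (x * (1 - \<theta>p * x)) powr \<alpha>p * cos (\<alpha>p * pi)
                  + lp * x powr (2 * \<alpha>p))) *
               indicator {y. 0 < y \<and> ereal y < 1 / ereal \<theta>p} x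
           + \<delta>m * (\<bar>x\<bar> powr (- \<gamma> + \<alpha>m - 1) / pi) *
               ((1 - \<theta>m * \<bar>x\<bar>) powr (\<alpha>m - 1) * sin (\<alpha>m * pi) /
                 (inverse lm * (1 - \<theta>m * \<bar>x\<bar>) powr (2 * \<alpha>m)
                  + 2 * (\<bar>x\<bar> * (1 - \<theta>m * \<bar>x\<bar>)) powr \<alpha>m * cos (\<alpha>m * pi)
                  + lm * \<bar>x\<bar> powr (2 * \<alpha>m))) *
               indicator {y. - (1 / ereal \<theta>m) < ereal y \<and> y < 0} x)" .
qed

end
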